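(* Let $p$ be a prime and $\mathcal{A}=\mathbb{Z}/p\mathbb{Z}$. If $\mu$ is a mixing quasi-Markov measure on $\mathcal{A}^{\mathbb{Z}}$, then $\mu$ is asymptotically randomized by every dispersive linear cellular automaton $\Phi:\mathcal{A}^{\mathbb{Z}}\to\mathcal{A}^{\mathbb{Z}}$.
   Context: Quasi-Markov measure: $\mu=\Psi(\nu)$ (pushforward), where $\mathcal{B}$ is a finite alphabet, $\mathfrak{F}\subset\mathcal{B}^{\mathbb{Z}}$ is a subshift of finite type, $\nu$ is a mixing $N$-step Markov chain (measure) on $\mathfrak{F}$ for some $N$, and $\Psi:\mathcal{B}^{\mathbb{Z}}\to\mathcal{A}^{\mathbb{Z}}$ is a block map (continuous and shift-commuting); thus $\mu$ is a measure on the sofic shift $\Psi(\mathfrak{F})$. With $\sigma^v(\mathbf{a})_m=a_{m-v}$, a linear cellular automaton (LCA) is $\Phi=\sum_{f\in\mathbb{F}}\varphi_f\sigma^f$ with $\mathbb{F}\subset\mathbb{Z}$ finite, $\#\mathbb{F}\ge2$, and nonzero coefficients $\varphi_f\in\mathbb{Z}$. $\mathbb{J}\subset\mathbb{N}$ has Cesàro density one if $\lim_{N\to\infty}\frac1N\#(\mathbb{J}\cap[0,N))=1$. $\Phi$ asymptotically randomizes $\mu$ if there is $\mathbb{J}\subset\mathbb{N}$ of Cesàro density one such that $\Phi^j\mu$ converges weak* to the uniform Bernoulli (Haar) measure on $\mathcal{A}^{\mathbb{Z}}$ as $j\to\infty$ in $\mathbb{J}$. A character of $\mathcal{A}^{\mathbb{Z}}$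 is a continuous homomorphism into the circle group; each has the form $\boldsymbol\chi(\mathbf{a})=\prod_{k\in\mathbb{K}}\chi_k(a_k)$ with $\mathbb{K}\subset\mathbb{Z}$ finite (its support) and each $\chi_k$ a nontrivial character of $\mathcal{A}$. For $S>0$, two characters with supports $\mathbb{K},\mathbb{X}$ are $S$-separated if $|k-x|\ge S$ for all $k\in\mathbb{K}$, $x\in\mathbb{X}$. For a nontrivial character $\boldsymbol\chi$, $\mathrm{rank}_S(\boldsymbol\chi)$ is the maximal $R$ such that $\boldsymbol\chi=\boldsymbol\chi_1\cdots\boldsymbol\chi_R$ for mutually $S$-separated nontrivial characters $\boldsymbol\chi_i$; for the trivial character put $\mathrm{rank}_S=0$. $\Phi$ is dispersive if for every $S>0$ and every nontrivial character $\boldsymbol\chi$ there is $\mathbb{J}\subset\mathbb{N}$ of Cesàro density one such that $\mathrm{rank}_S(\boldsymbol\chi\circ\Phi^j)\to\infty$ as $j\to\infty$ in $\mathbb{J}$.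
   Formalization: The measure μ is additionally assumed not to be a point mass; without this the claim is false, since the point mass at the zero configuration is a mixing quasi-Markov measure fixed by every linear cellular automaton, including the dispersive 1+σ. *)

theory Defs
  imports
    "HOL-Probability.Probability"
    "HOL-Library.Function_Algebras"
    "Berlekamp_Zassenhaus.Finite_Field"
begin

section \<open>Configurations\<close>

text \<open>
  The group \<open>\<int>/p\<int>\<close> is the type \<open>'p mod_ring\<close> with \<open>'p :: prime_card\<close>; an arbitrary prime \<open>p\<close> is an
  arbitrary such type, \<open>p = CARD('p)\<close>.  Configurations are functions on \<open>int\<close>, added pointwise.
  Finite alphabets carry no \<open>topological_space\<close> instance, so the product topology is given
  explicitly; on a finite alphabet its Borel sets are exactly the measurable sets of
  \<open>config_space\<close>.
\<close>

definition config_topology :: "(int \<Rightarrow> 'a) topology" where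
  "config_topology = product_topology (\<lambda>_. discrete_topology UNIV) UNIV"

definition config_space :: "(int \<Rightarrow> 'a) measure" where
  "config_space = (\<Pi>\<^sub>M _\<in>UNIV. count_space UNIV)"

definition config_prob :: "(int \<Rightarrow> 'a) measure \<Rightarrow> bool" where
  "config_prob \<mu> \<longleftrightarrow> prob_space \<mu> \<and> sets \<mu> = sets config_space"

definition config_shift :: "int \<Rightarrow> (int \<Rightarrow> 'a) \<Rightarrow> (int \<Rightarrow> 'a)" where
  "config_shift v a = (\<lambda>m. a (m - v))"

definition uniform_bernoulli :: "(int \<Rightarrow> 'a::finite) measure" where
  "uniform_bernoulli = (\<Pi>\<^sub>M _\<in>UNIV. uniform_count_measure UNIV)"


section \<open>Quasi-Markov measures\<close>

definition block :: "(int \<Rightarrow> 'b) \<Rightarrow> int \<Rightarrow> nat \<Rightarrow> 'b list" where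
  "block b k n = map (\<lambda>i. b (k + int i)) [0..<n]"

definition cylinder :: "int \<Rightarrow> 'b list \<Rightarrow> (int \<Rightarrow> 'b) set" where
  "cylinder k w = {b. block b k (length w) = w}"

definition subshift_of_finite_type :: "(int \<Rightarrow> 'b) set \<Rightarrow> bool" where
  "subshift_of_finite_type \<FF> \<longleftrightarrow>
     (\<exists>forbidden. finite forbidden \<and> \<FF> = {b. \<forall>w\<in>forbidden. \<forall>k. b \<notin> cylinder k w})"

definition shift_invariant :: "(int \<Rightarrow> 'a) measure \<Rightarrow> bool" where
  "shift_invariant \<mu> \<longleftrightarrow> (\<forall>v. distr \<mu> \<mu> (config_shift v) = \<mu>)"

definition shift_mixing :: "(int \<Rightarrow> 'a) measure \<Rightarrow> bool" where
  "shift_mixing \<mu> \<longleftrightarrow> shift_invariant \<mu> \<and>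
     (\<forall>A\<in>sets \<mu>. \<forall>B\<in>sets \<mu>.
        (\<lambda>n. measure \<mu> (config_shift (int n) -` A \<inter> B)) \<longlonglongrightarrow> measure \<mu> A * measure \<mu> B)"

text \<open>
  Conditionally on a past of length at least \<open>N\<close> and of positive probability, the next symbol
  depends only on the last \<open>N\<close> symbols \<open>w\<close>.  Stationarity is part of \<open>shift_mixing\<close>.
\<close>

definition markov_measure :: "nat \<Rightarrow> (int \<Rightarrow> 'b) measure \<Rightarrow> bool" where
  "markov_measure N \<nu> \<longleftrightarrow> config_prob \<nu> \<and>
     (\<forall>k u w c. length w = N \<longrightarrow> measure \<nu> (cylinder k (u @ w)) \<noteq> 0 \<longrightarrow>
        measure \<nu> (cylinder k (u @ w @ [c])) / measure \<nu> (cylinder k (u @ w)) =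
        measure \<nu> (cylinder (k + int (length u)) (w @ [c])) /
          measure \<nu> (cylinder (k + int (length u)) w))"

definition block_map :: "((int \<Rightarrow> 'b) \<Rightarrow> (int \<Rightarrow> 'a)) \<Rightarrow> bool" where
  "block_map \<Psi> \<longleftrightarrow> continuous_map config_topology config_topology \<Psi> \<and>
     (\<forall>v b. \<Psi> (config_shift v b) = config_shift v (\<Psi> b))"

text \<open>
  HOL has no existential quantification over types, so the finite alphabet \<open>\<B>\<close> is the type
  argument \<open>'b\<close>; a theorem assuming \<open>quasi_markov TYPE('b) \<mu>\<close> covers all finite alphabets.
\<close>

definition quasi_markov :: "'b::finite itself \<Rightarrow> (int \<Rightarrow> 'a) measure \<Rightarrow> bool" where
  "quasi_markov _ \<mu> \<longleftrightarrow>
     (\<exists>(\<FF> :: (int \<Rightarrow> 'b) set) \<nu> N \<Psi>.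
        subshift_of_finite_type \<FF> \<and>
        markov_measure N \<nu> \<and> (AE b in \<nu>. b \<in> \<FF>) \<and> shift_mixing \<nu> \<and>
        block_map \<Psi> \<and> \<mu> = distr \<nu> config_space \<Psi>)"


section \<open>Linear cellular automata\<close>

definition linear_CA :: "((int \<Rightarrow> 'p::prime_card mod_ring) \<Rightarrow> (int \<Rightarrow> 'p mod_ring)) \<Rightarrow> bool" where
  "linear_CA \<Phi> \<longleftrightarrow>
     (\<exists>F (\<phi> :: int \<Rightarrow> int). finite F \<and> card F \<ge> 2 \<and> (\<forall>f\<in>F. \<phi> f \<noteq> 0) \<and>
        \<Phi> = (\<lambda>a m. \<Sum>f\<in>F. of_int (\<phi> f) * config_shift f a m))"

definition cesaro_density_one :: "nat set \<Rightarrow> bool" where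
  "cesaro_density_one J \<longleftrightarrow> (\<lambda>N. real (card (J \<inter> {0..<N})) / real N) \<longlonglongrightarrow> 1"

text \<open>\<open>j \<rightarrow> \<infinity>\<close> in \<open>J\<close>\<close>

definition seq_in :: "nat set \<Rightarrow> nat filter" where
  "seq_in J = inf sequentially (principal J)"

definition weak_star_tendsto ::
    "('i \<Rightarrow> (int \<Rightarrow> 'a) measure) \<Rightarrow> (int \<Rightarrow> 'a) measure \<Rightarrow> 'i filter \<Rightarrow> bool" where
  "weak_star_tendsto M L G \<longleftrightarrow>
     (\<forall>h :: (int \<Rightarrow> 'a) \<Rightarrow> real. continuous_map config_topology euclidean h \<longrightarrow>
        ((\<lambda>i. \<integral>a. h a \<partial>M i) \<longlongrightarrow> (\<integral>a. h a \<partial>L)) G)"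

definition asymptotically_randomizes ::
    "((int \<Rightarrow> 'a::finite) \<Rightarrow> (int \<Rightarrow> 'a)) \<Rightarrow> (int \<Rightarrow> 'a) measure \<Rightarrow> bool" where
  "asymptotically_randomizes \<Phi> \<mu> \<longleftrightarrow>
     (\<exists>J. cesaro_density_one J \<and>
        weak_star_tendsto (\<lambda>j. distr \<mu> config_space (\<Phi> ^^ j)) uniform_bernoulli (seq_in J))"


section \<open>Characters, rank and dispersion\<close>

definition character :: "'g::ab_group_add topology \<Rightarrow> ('g \<Rightarrow> complex) \<Rightarrow> bool" where
  "character T \<theta> \<longleftrightarrow> continuous_map T euclidean \<theta> \<and> (\<forall>x. norm (\<theta> x) = 1) \<and>
     (\<forall>x y. \<theta> (x + y) = \<theta> x * \<theta> y)"

definition nontrivial_character :: "'g::ab_group_add topology \<Rightarrow> ('g \<Rightarrow> complex) \<Rightarrow> bool" where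
  "nontrivial_character T \<theta> \<longleftrightarrow> character T \<theta> \<and> \<theta> \<noteq> (\<lambda>_. 1)"

text \<open>
  The factorization of a character of a configuration space into nontrivial characters of the
  alphabet exists and is unique when the alphabet is finite, so the description is proper.
\<close>

definition char_support :: "((int \<Rightarrow> 'a::ab_group_add) \<Rightarrow> complex) \<Rightarrow> int set" where
  "char_support \<theta> =
     (THE K. finite K \<and>
        (\<exists>\<psi>. (\<forall>k\<in>K. nontrivial_character (discrete_topology UNIV) (\<psi> k)) \<and>
              \<theta> = (\<lambda>a. \<Prod>k\<in>K. \<psi> k (a k))))"

definition separated ::
    "real \<Rightarrow> ((int \<Rightarrow> 'a::ab_group_add) \<Rightarrow> complex) \<Rightarrow> ((int \<Rightarrow> 'a) \<Rightarrow> complex) \<Rightarrow> bool" where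
  "separated S \<theta> \<xi> \<longleftrightarrow>
     (\<forall>k\<in>char_support \<theta>. \<forall>x\<in>char_support \<xi>. real_of_int \<bar>k - x\<bar> \<ge> S)"

definition char_rank :: "real \<Rightarrow> ((int \<Rightarrow> 'a::ab_group_add) \<Rightarrow> complex) \<Rightarrow> nat" where
  "char_rank S \<theta> =
     (if \<theta> = (\<lambda>_. 1) then 0
      else Max {R. \<exists>\<xi>. (\<forall>i<R. nontrivial_character config_topology (\<xi> i)) \<and>
                       (\<forall>i<R. \<forall>j<R. i \<noteq> j \<longrightarrow> separated S (\<xi> i) (\<xi> j)) \<and>
                       \<theta> = (\<lambda>a. \<Prod>i<R. \<xi> i a)})"

definition dispersive :: "((int \<Rightarrow> 'a::ab_group_add) \<Rightarrow> (int \<Rightarrow> 'a)) \<Rightarrow> bool" where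
  "dispersive \<Phi> \<longleftrightarrow>
     (\<forall>S>0. \<forall>\<theta>. nontrivial_character config_topology \<theta> \<longrightarrow>
        (\<exists>J. cesaro_density_one J \<and>
             filterlim (\<lambda>j. char_rank S (\<theta> \<circ> (\<Phi> ^^ j))) at_top (seq_in J)))"

end

theory Submission
  imports Defs
begin

text \<open>
  Let \<open>\<mu>\<close> be the image of the Markov measure \<open>\<nu>\<close> under the block map \<open>\<Psi>\<close>.  A measure on
  \<open>(\<int>/p\<int>)\<^sup>\<int>\<close> is determined by its Fourier coefficients, the integrals of characters, and the
  coefficient of \<open>\<Phi>\<^sup>j\<mu>\<close> at \<open>\<theta>\<close> is the coefficient of \<open>\<mu>\<close> at \<open>\<theta> \<circ> \<Phi>\<^sup>j\<close>.  Dispersion makes the rank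
  of \<open>\<theta> \<circ> \<Phi>\<^sup>j\<close> grow along a set of density one, so the heart of the matter is that the Fourier
  coefficients of \<open>\<mu>\<close> decay exponentially in the rank: there are \<open>S > 0\<close> and \<open>\<rho> < 1\<close> with
  \<open>\<bar>\<integral>\<theta> d\<mu>\<bar> \<le> \<rho> ^ rank\<^sub>S \<theta>\<close> for every character \<open>\<theta>\<close> (\<open>quasi_markov_character_decay\<close>).

  To see this, pull \<open>\<theta>\<close> back to \<open>\<nu>\<close>.  A character of rank \<open>R\<close> has \<open>R\<close> coordinates in its support,
  pairwise at distance at least \<open>S\<close>, each followed by a gap of length \<open>S\<close> in the support: the right
  ends of the \<open>R\<close> factors (\<open>char_rank_witness\<close>).  Around each of them place a window of length \<open>S\<close>
  and condition \<open>\<nu>\<close> on the words at both ends of the window.  By the Markov property the windows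
  decouple, and each contributes a factor \<open>\<rho>\<close> as soon as the restriction of \<open>\<theta>\<close> to the window is
  not constant on the paths joining the two end words; there are finitely many paths, and the values
  of \<open>\<theta>\<close> are \<open>p\<close>-th roots of unity, so \<open>\<rho>\<close> is uniform (\<open>spectral_gap\<close>).

  Suppose the restriction were constant (\<open>phase_varies\<close>).  Since \<open>\<theta>\<close> is trivial between the marked
  coordinate and the right end of the window, and mixing lets every path be continued to the
  prescribed right end, the product of the factors of \<open>\<theta>\<close> up to the marked coordinate depends only
  on the left end.  The factor at the marked coordinate is a nontrivial character of a group of prime
  order, hence injective.  Comparing paths that part one step, two steps, \<open>\<dots>\<close> before the marked
  coordinate shows inductively that the symbol of \<open>\<Psi>\<close> is a function of the word seen \<open>k\<close>
  steps earlier, for all \<open>k\<close> that the window has room for.  Once \<open>k\<close> exceeds the mixing time,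
  every word can be reached from every other one, so this symbol is almost surely constant
  and \<open>\<mu>\<close> is a point mass, which is excluded.

  There remain two routine steps.  The Fourier coefficients of cylinders show that it is enough to
  control countably many characters (\<open>equidistribution_criterion\<close>), and countably many sets of
  density one admit a single set of density one that is eventually contained in each of them
  (\<open>cesaro_density_one_diagonal\<close>).
\<close>

section \<open>Words and weighted sums of unimodular numbers\<close>

definition words :: "nat \<Rightarrow> 'b list set" where
  "words m = {w. length w = m}"

lemma finite_words [simp]: "finite (words m :: 'b::finite list set)"
  using finite_lists_length_eq[of "UNIV :: 'b set" m] by (simp add: words_def)

lemma words_0 [simp]: "words 0 = {[]}"
  by (auto simp: words_def)

lemma sum_words_add:
  fixes g :: "'b::finite list \<Rightarrow> 'c::comm_monoid_add"
  shows "(\<Sum>w\<in>words (k + m). g w) = (\<Sum>u\<in>words k. \<Sum>v\<in>words m. g (u @ v))"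
proof -
  have "(\<Sum>u\<in>words k. \<Sum>v\<in>words m. g (u @ v)) = (\<Sum>(u, v)\<in>words k \<times> words m. g (u @ v))"
    by (rule sum.cartesian_product)
  also have "\<dots> = (\<Sum>w\<in>words (k + m). g w)"
    by (rule sum.reindex_bij_witness[where i = "\<lambda>w. (take k w, drop k w)" and j = "\<lambda>(u, v). u @ v"])
      (auto simp: words_def)
  finally show ?thesis ..
qed

lemma sum_words_1:
  fixes g :: "'b::finite list \<Rightarrow> 'c::comm_monoid_add"
  shows "(\<Sum>w\<in>words 1. g w) = (\<Sum>c\<in>UNIV. g [c])"
  by (rule sum.reindex_bij_witness[where i = "\<lambda>c. [c]" and j = hd])
    (auto simp: words_def length_Suc_conv)

lemma sum_words_Suc_left:
  fixes g :: "'b::finite list \<Rightarrow> 'c::comm_monoid_add"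
  shows "(\<Sum>w\<in>words (Suc k). g w) = (\<Sum>c\<in>UNIV. \<Sum>v\<in>words k. g (c # v))"
  using sum_words_add[of g 1 k] sum_words_1[of "\<lambda>u. \<Sum>v\<in>words k. g (u @ v)"] by simp

lemma norm_add_distinct_unimodular:
  fixes z w :: complex
  assumes "norm z = 1" "norm w = 1" "z \<noteq> w"
  shows "norm (z + w) < 2"
proof -
  have "norm (z + w)^2 + norm (z - w)^2 = 2 * norm z ^ 2 + 2 * norm w ^ 2"
    unfolding cmod_power2 by (simp add: power2_eq_square algebra_simps)
  with assms have "norm (z + w)^2 + norm (z - w)^2 = 4" by simp
  moreover have "norm (z - w)^2 > 0" using assms by simp
  ultimately have "norm (z + w)^2 < 4" by linarith
  then have "norm (z + w)^2 < 2^2" by simp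
  then show ?thesis by (rule power_less_imp_less_base) simp
qed

text \<open>
  There are finitely many pairs of \<open>P\<close>-th roots of unity, so the strict triangle inequality for
  distinct unimodular numbers is uniform.
\<close>

lemma roots_of_unity_gap:
  assumes "P > 0"
  obtains c :: real where "c > 0"
    "\<And>z w :: complex. z ^ P = 1 \<Longrightarrow> w ^ P = 1 \<Longrightarrow> z \<noteq> w \<Longrightarrow> norm (z + w) \<le> 2 - c"
proof -
  define S where "S = {z :: complex. z ^ P = 1}"
  define D where "D = insert 1 ((\<lambda>(z, w). 2 - norm (z + w)) ` {(z, w) \<in> S \<times> S. z \<noteq> w})"
  have fS: "finite S"
    unfolding S_def using assms by (intro finite_roots_unity) simp
  have fD: "finite D" unfolding D_def using fS
    by (auto intro: finite_subset[of _ "S \<times> S"])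
  have un: "norm z = 1" if "z \<in> S" for z
  proof -
    have "norm z ^ P = 1 ^ P" using that by (simp add: S_def flip: norm_power)
    then show ?thesis using assms power_eq_imp_eq_base[of "norm z" P 1] by simp
  qed
  have pos: "d > 0" if "d \<in> D" for d
    using that un norm_add_distinct_unimodular unfolding D_def by force
  show thesis
  proof (rule that[of "Min D"])
    show "Min D > 0" using pos fD by (subst Min_gr_iff) (auto simp: D_def)
    fix z w :: complex assume "z ^ P = 1" "w ^ P = 1" "z \<noteq> w"
    then have "2 - norm (z + w) \<in> D" unfolding D_def S_def by force
    then have "Min D \<le> 2 - norm (z + w)" using fD by simp
    then show "norm (z + w) \<le> 2 - Min D" by simp
  qed
qed

text \<open>
  The quantitative form of strict convexity of the disc: taking weight \<open>q0\<close> out of the two terms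
  \<open>i\<close> and \<open>j\<close> and pairing it, the sum loses \<open>q0 * c\<close> against the triangle inequality.
\<close>

lemma norm_weighted_sum_gap:
  fixes q :: "'i \<Rightarrow> real" and g :: "'i \<Rightarrow> complex"
  assumes fin: "finite I" and i: "i \<in> I" and j: "j \<in> I" and ne: "i \<noteq> j"
    and q: "\<And>k. k \<in> I \<Longrightarrow> 0 \<le> q k" and g: "\<And>k. k \<in> I \<Longrightarrow> norm (g k) = 1"
    and q0: "0 \<le> q0" "q0 \<le> q i" "q0 \<le> q j" and c: "norm (g i + g j) \<le> 2 - c"
  shows "norm (\<Sum>k\<in>I. q k * g k) \<le> (\<Sum>k\<in>I. q k) - q0 * c"
proof -
  have split: "(\<Sum>k\<in>I. f k) = f i + f j + (\<Sum>k\<in>I - {i, j}. f k)" for f :: "'i \<Rightarrow> 'z::comm_monoid_add"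
    using fin i j ne by (simp add: sum.remove[of I i] sum.remove[of "I - {i}" j] Diff_insert2 [symmetric] insert_commute ac_simps)
  have "norm (q i * g i + q j * g j)
      = norm (complex_of_real (q i - q0) * g i + complex_of_real (q j - q0) * g j + q0 * (g i + g j))"
    by (simp add: algebra_simps)
  also have "\<dots> \<le> (q i - q0) + (q j - q0) + q0 * (2 - c)"
    using q0 g[OF i] g[OF j] c
    by (intro norm_triangle_mono) (auto simp: norm_mult mult_left_mono simp flip: of_real_diff)
  finally have 1: "norm (q i * g i + q j * g j) \<le> q i + q j - q0 * c"
    by (simp add: algebra_simps)
  have 2: "norm (\<Sum>k\<in>I - {i, j}. q k * g k) \<le> (\<Sum>k\<in>I - {i, j}. q k)"
    using q g by (intro sum_norm_le) (auto simp: norm_mult)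
  show ?thesis
    unfolding split[of "\<lambda>k. complex_of_real (q k) * g k"] split[of q]
    using norm_triangle_mono[OF 1 2] by simp
qed

section \<open>Stationary Markov word probabilities\<close>

text \<open>
  The distribution of a stationary process on words.  The last assumption says that past and future
  are independent given \<open>n\<close> consecutive letters; it is written multiplicatively so that
  it also makes sense for words of probability zero.
\<close>

locale word_chain =
  fixes p :: "'b::finite list \<Rightarrow> real" and n :: nat
  assumes nonneg: "0 \<le> p w"
    and nil: "p [] = 1"
    and sum_snoc: "(\<Sum>c\<in>UNIV. p (w @ [c])) = p w"
    and sum_Cons: "(\<Sum>c\<in>UNIV. p (c # w)) = p w"
    and markov: "length w = n \<Longrightarrow> p (u @ w @ v) * p w = p (u @ w) * p (w @ v)"
begin

lemma sum_append_right: "(\<Sum>v\<in>words k. p (w @ v)) = p w"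
proof (induction k arbitrary: w)
  case (Suc k)
  have "(\<Sum>v\<in>words (Suc k). p (w @ v)) = (\<Sum>c\<in>UNIV. \<Sum>v\<in>words k. p ((w @ [c]) @ v))"
    by (simp add: sum_words_Suc_left)
  then show ?case by (simp only: Suc sum_snoc)
qed simp

lemma sum_append_left: "(\<Sum>v\<in>words k. p (v @ w)) = p w"
proof (induction k)
  case (Suc k)
  have "(\<Sum>v\<in>words (Suc k). p (v @ w)) = (\<Sum>v\<in>words k. \<Sum>c\<in>UNIV. p (c # v @ w))"
    by (simp add: sum_words_Suc_left sum.swap[of _ "words k"])
  then show ?case by (simp only: Suc sum_Cons)
qed simp

lemma sum_words: "(\<Sum>w\<in>words k. p w) = 1"
  using sum_append_right[of "[]" k] nil by simp

lemma append_left_le: "p (u @ w) \<le> p w"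
proof -
  have "p (u @ w) \<le> (\<Sum>v\<in>words (length u). p (v @ w))"
    by (rule member_le_sum) (auto simp: nonneg words_def[of "length u"] finite_words[unfolded words_def])
  then show ?thesis by (simp only: sum_append_left)
qed

lemma append_right_le: "p (w @ v) \<le> p w"
proof -
  have "p (w @ v) \<le> (\<Sum>v\<in>words (length v). p (w @ v))"
    by (rule member_le_sum) (auto simp: nonneg words_def[of "length v"] finite_words[unfolded words_def])
  then show ?thesis by (simp only: sum_append_right)
qed

lemma pos_leftD: "0 < p (u @ w) \<Longrightarrow> 0 < p u"
  using append_right_le[of u w] by simp

lemma pos_rightD: "0 < p (u @ w) \<Longrightarrow> 0 < p w"
  using append_left_le[of u w] by simp

lemma glue: "length w = n \<Longrightarrow> 0 < p (u @ w) \<Longrightarrow> 0 < p (w @ v) \<Longrightarrow> 0 < p (u @ w @ v)"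
  using markov[of w u v] pos_rightD[of u w] by (metis mult_pos_pos zero_less_mult_pos2)

end

section \<open>The gap produced by one window\<close>

text \<open>
  A mixing chain together with a code \<open>\<psi>\<close> that reads one symbol off each word of length \<open>n\<close>.
  Mixing enters only as the bound \<open>M\<close> on the lengths in which two words of positive probability can
  be joined.
\<close>

locale coded_word_chain = word_chain p n for p :: "'b::finite list \<Rightarrow> real" and n +
  fixes M :: nat and \<psi> :: "'b list \<Rightarrow> 'a"
  assumes connect: "length x = n \<Longrightarrow> length y = n \<Longrightarrow> 0 < p x \<Longrightarrow> 0 < p y \<Longrightarrow> M \<le> m
      \<Longrightarrow> \<exists>s\<in>words m. 0 < p (x @ s @ y)"
    and nonconst: "\<exists>x y. length x = n \<and> length y = n \<and> 0 < p x \<and> 0 < p y \<and> \<psi> x \<noteq> \<psi> y"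
begin

text \<open>
  The value of the character \<open>\<Prod>\<^sub>k e k\<close> on the coded image of \<open>w\<close>, where the first \<open>n\<close> letters of
  \<open>w\<close> encode the symbol at coordinate \<open>a\<close>.  The symbol encoded by the last \<open>n\<close> letters
  is left out, since it is the first symbol of the next word; this makes \<open>phase\<close> multiplicative
  along words that overlap in \<open>n\<close> letters.
\<close>

definition phase :: "(int \<Rightarrow> 'a \<Rightarrow> complex) \<Rightarrow> int \<Rightarrow> 'b list \<Rightarrow> complex" where
  "phase e a w = (\<Prod>i<length w - n. e (a + int i) (\<psi> (take n (drop i w))))"

lemma phase_append:
  assumes "length y = n"
  shows "phase e a (u @ y @ v) = phase e a (u @ y) * phase e (a + int (length u)) (y @ v)"
proof -
  have "phase e a (u @ y @ v)
      = (\<Prod>i\<in>{0..<length u}. e (a + int i) (\<psi> (take n (drop i (u @ y @ v))))) *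
        (\<Prod>i\<in>{length u..<length u + length v}. e (a + int i) (\<psi> (take n (drop i (u @ y @ v)))))"
    using assms unfolding phase_def lessThan_atLeast0 by (subst prod.atLeastLessThan_concat) auto
  also have "(\<Prod>i\<in>{0..<length u}. e (a + int i) (\<psi> (take n (drop i (u @ y @ v))))) = phase e a (u @ y)"
    using assms unfolding phase_def by (intro prod.cong) auto
  also have "(\<Prod>i\<in>{length u..<length u + length v}. e (a + int i) (\<psi> (take n (drop i (u @ y @ v)))))
      = phase e (a + int (length u)) (y @ v)"
    using assms prod.shift_bounds_nat_ivl[of "\<lambda>i. e (a + int i) (\<psi> (take n (drop i (u @ y @ v))))" 0 "length u" "length v"]
    by (simp add: phase_def lessThan_atLeast0 ac_simps)
  finally show ?thesis .
qed

text \<open>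
  A window covers \<open>window_length\<close> coordinates, and the marked coordinate sits at \<open>window_offset\<close>.
  The \<open>2 * (n + M)\<close> coordinates before it leave room for a path of length \<open>n + M\<close> from the left end
  and then for the \<open>n + M\<close> steps over which the marked symbol is traced back; the \<open>n + M\<close>
  coordinates from the marked one onwards leave room for a path to the right end.
\<close>

definition window_offset :: nat where "window_offset = 2 * (n + M)"
definition window_length :: nat where "window_length = 3 * (n + M)"

text \<open>
  Otherwise the symbol at the marked coordinate is determined by the past.  For \<open>k\<close> up to \<open>n + M\<close>,
  two words of length \<open>k + n\<close> with the same first \<open>n\<close> letters have the same last symbol: embed both in
  paths from \<open>y\<close> to \<open>y'\<close> with their last symbol at the marked coordinate.  The factors
  before it agree, by equality of the prefixes or by induction, the factors after it are trivial, and
  so the factors at the marked coordinate agree as well; these are injective.  For \<open>k = n + M\<close> the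
  last \<open>n\<close> letters are arbitrary, and the code would be constant.
\<close>

lemma phase_varies:
  assumes e0: "\<And>k x. e k x \<noteq> 0"
    and inj: "inj (e (a + int window_offset))"
    and triv: "\<And>i. window_offset < i \<Longrightarrow> i < window_length \<Longrightarrow> e (a + int i) = (\<lambda>_. 1)"
    and y: "length y = n" "0 < p y" and y': "length y' = n" "0 < p y'"
  shows "\<exists>v1\<in>words (window_length - n). \<exists>v2\<in>words (window_length - n). 0 < p (y @ v1 @ y') \<and> 0 < p (y @ v2 @ y')
      \<and> phase e a (y @ v1 @ y') \<noteq> phase e a (y @ v2 @ y')"
proof (rule ccontr)
  assume "\<not> ?thesis"
  then have const: "phase e a (y @ v1 @ y') = phase e a (y @ v2 @ y')"
    if "v1 \<in> words (window_length - n)" "v2 \<in> words (window_length - n)" "0 < p (y @ v1 @ y')" "0 < p (y @ v2 @ y')"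
    for v1 v2 using that by blast
  have determ: "\<psi> (drop k z1) = \<psi> (drop k z2)"
    if "k \<le> n + M" "length z1 = k + n" "length z2 = k + n" "0 < p z1" "0 < p z2" "take n z1 = take n z2"
    for k z1 z2
    using that
  proof (induction k arbitrary: z1 z2 rule: less_induct)
    case (less k)
    define x where "x = take n z1"
    have x: "length x = n" "x = take n z2" "z1 = x @ drop n z1" "z2 = x @ drop n z2"
      using less.prems append_take_drop_id[of n z1] append_take_drop_id[of n z2]
      by (auto simp: x_def)
    have "0 < p x" using less.prems(4) pos_leftD x(3) by metis
    then obtain s where s: "length s = window_offset - k - n" "0 < p (y @ s @ x)"
    proof -
      have "M \<le> window_offset - k - n" using less.prems(1) by (simp add: window_offset_def)
      then show ?thesis
        using connect[OF y(1) x(1) y(2) \<open>0 < p x\<close>] that by (auto simp: words_def)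
    qed
    have len: "length (y @ s) = window_offset - k" using s y less.prems(1) by (simp add: window_offset_def)
    have ext: "\<exists>t. length t = M \<and> 0 < p (y @ (s @ z @ t) @ y')"
      if z: "length z = k + n" "0 < p z" "take n z = x" for z
    proof -
      have "0 < p (drop k z)" using z(2) pos_rightD[of "take k z" "drop k z"] by simp
      then obtain t where t: "length t = M" "0 < p (drop k z @ t @ y')"
        using connect[of "drop k z" y' M] y' z by (auto simp: words_def)
      have xz: "x @ drop n z = z" unfolding z(3)[symmetric] by (rule append_take_drop_id)
      have "0 < p ((y @ s) @ x @ drop n z)"
        using s(2) x(1) z(2) by (intro glue) (simp_all add: xz)
      then have "0 < p ((y @ s) @ z)" by (simp add: xz)
      then have "0 < p ((y @ s @ take k z) @ drop k z)" by simp
      then have "0 < p ((y @ s @ take k z) @ drop k z @ t @ y')"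
        using t(2) z(1) by (intro glue[of "drop k z" "y @ s @ take k z" "t @ y'"]) simp_all
      then have "0 < p (y @ s @ (take k z @ drop k z) @ t @ y')"
        by (simp del: append_take_drop_id)
      then show ?thesis using t by auto
    qed
    obtain t1 where t1: "length t1 = M" "0 < p (y @ (s @ z1 @ t1) @ y')"
      using ext[of z1] less.prems by (auto simp: x_def)
    obtain t2 where t2: "length t2 = M" "0 < p (y @ (s @ z2 @ t2) @ y')"
      using ext[of z2] less.prems by (auto simp: x_def)
    have lens: "s @ z1 @ t1 \<in> words (window_length - n)" "s @ z2 @ t2 \<in> words (window_length - n)"
      using s t1 t2 less.prems by (auto simp: words_def window_length_def window_offset_def)
    define F where "F z t i = e (a + int i) (\<psi> (take n (drop i (y @ (s @ z @ t) @ y'))))" for z t i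
    have phase_split: "phase e a (y @ (s @ z @ t) @ y') = (\<Prod>i<window_offset. F z t i) * F z t window_offset"
      if "length z = k + n" "length t = M" for z t
    proof -
      have "phase e a (y @ (s @ z @ t) @ y') = (\<Prod>i<window_length. F z t i)"
        unfolding phase_def F_def using that s y y' less.prems
        by (intro prod.cong) (auto simp: window_length_def window_offset_def)
      also have "\<dots> = (\<Prod>i<Suc window_offset. F z t i)"
      proof (cases "n + M = 0")
        case True
        \<comment> \<open>There is only one word of length 0, so a nonconstant code forces \<open>n > 0\<close>.\<close>
        then show ?thesis using y nonconst by auto
      next
        case False
        then show ?thesis
          by (intro prod.mono_neutral_right) (auto simp: F_def triv window_length_def window_offset_def)
      qed
      finally show ?thesis by simp
    qed
    \<comment> \<open>Symbols before the word \<open>z\<close> are read off a common prefix; those inside it, at distance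
      \<open>l < k\<close> from its start, agree by the induction hypothesis for the prefix of length \<open>l + n\<close>.\<close>
    have F_eq: "F z1 t1 i = F z2 t2 i" if "i < window_offset" for i
    proof (cases "i < window_offset - k")
      case True
      have "take n (drop i (y @ (s @ z @ t) @ y')) = take n (drop i (y @ s @ x))"
        if "length z = k + n" "take n z = x" for z t
      proof -
        have "y @ (s @ z @ t) @ y' = (y @ s @ x) @ drop n z @ t @ y'"
          using that append_take_drop_id[of n z] by (metis append.assoc)
        moreover have "take n (drop i ((y @ s @ x) @ w)) = take n (drop i (y @ s @ x))" for w
        proof -
          have "i + n \<le> length (y @ s @ x)" using True len x(1) by simp
          then show ?thesis by (simp only: drop_append take_append) simp
        qed
        ultimately show ?thesis by metis
      qed
      then show ?thesis using less.prems x unfolding F_def x_def by metis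
    next
      case False
      define l where "l = i - (window_offset - k)"
      have l: "l < k" "i = length (y @ s) + l" using False that len less.prems(1) by (auto simp: l_def window_offset_def)
      have tk: "take n (drop i (y @ (s @ z @ t) @ y')) = drop l (take (l + n) z)"
        if "length z = k + n" for z t
      proof -
        have "drop i (y @ (s @ z @ t) @ y') = drop l (z @ t @ y')"
          unfolding l(2) by simp
        then show ?thesis using that l(1) by (simp add: drop_take)
      qed
      have "\<psi> (drop l (take (l + n) z1)) = \<psi> (drop l (take (l + n) z2))"
      proof (rule less.IH)
        show "0 < p (take (l + n) z1)" using less.prems(4) pos_leftD append_take_drop_id by metis
        show "0 < p (take (l + n) z2)" using less.prems(5) pos_leftD append_take_drop_id by metis
      qed (use l less.prems in \<open>auto simp: min_def\<close>)
      then show ?thesis unfolding F_def using tk less.prems by simp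
    qed
    have F_offset: "F z t window_offset = e (a + int window_offset) (\<psi> (drop k z))" if "length z = k + n" for z t
    proof -
      have "window_offset = length (y @ s) + k" using len less.prems(1) by (simp add: window_offset_def)
      then have "drop window_offset (y @ (s @ z @ t) @ y') = drop k (z @ t @ y')" by simp
      then show ?thesis using that by (simp add: F_def)
    qed
    have "(\<Prod>i<window_offset. F z1 t1 i) * F z1 t1 window_offset = (\<Prod>i<window_offset. F z2 t2 i) * F z2 t2 window_offset"
      using const[OF lens t1(2) t2(2)] t1 t2 less.prems by (simp only: phase_split)
    moreover have "(\<Prod>i<window_offset. F z1 t1 i) = (\<Prod>i<window_offset. F z2 t2 i)"
      using F_eq by (intro prod.cong) auto
    moreover have "(\<Prod>i<window_offset. F z2 t2 i) \<noteq> 0" using e0 by (simp add: F_def)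
    ultimately have "F z1 t1 window_offset = F z2 t2 window_offset" by simp
    then show ?case using F_offset less.prems inj by (simp add: inj_eq)
  qed
  obtain x1 x2 where x: "length x1 = n" "length x2 = n" "0 < p x1" "0 < p x2" "\<psi> x1 \<noteq> \<psi> x2"
    using nonconst by blast
  obtain s1 s2 where s: "length s1 = M" "length s2 = M" "0 < p (y @ s1 @ x1)" "0 < p (y @ s2 @ x2)"
    using connect[of y x1 M] connect[of y x2 M] x y by (auto simp: words_def)
  have "\<psi> (drop (n + M) (y @ s1 @ x1)) = \<psi> (drop (n + M) (y @ s2 @ x2))"
    by (rule determ) (use s x(1,2) y(1) in simp_all)
  moreover have "drop (n + M) (y @ s1 @ x1) = x1" "drop (n + M) (y @ s2 @ x2) = x2"
    using s(1,2) y(1) by simp_all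
  ultimately show False using x(5) by simp
qed

lemma norm_phase: "(\<And>k x. norm (e k x) = 1) \<Longrightarrow> norm (phase e a w) = 1"
  by (simp add: phase_def flip: prod_norm)

text \<open>
  The constant is uniform in the character, the position and the end words: only finitely many
  words fit into a window, so the positive ones have a least probability \<open>q0\<close>, and two distinct
  phases are distinct roots of unity.
\<close>

lemma spectral_gap:
  assumes P: "P > 0"
  obtains \<rho> where "0 \<le> \<rho>" "\<rho> < 1"
    "\<And>e a y y'. (\<And>k x. e k x ^ P = 1) \<Longrightarrow> inj (e (a + int window_offset)) \<Longrightarrow>
       (\<And>i. window_offset < i \<Longrightarrow> i < window_length \<Longrightarrow> e (a + int i) = (\<lambda>_. 1)) \<Longrightarrow>
       length y = n \<Longrightarrow> length y' = n \<Longrightarrow>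
       norm (\<Sum>v\<in>words (window_length - n). p (y @ v @ y') * phase e a (y @ v @ y'))
         \<le> \<rho> * (\<Sum>v\<in>words (window_length - n). p (y @ v @ y'))"
proof -
  obtain c :: real where c: "c > 0"
    "\<And>z w :: complex. z ^ P = 1 \<Longrightarrow> w ^ P = 1 \<Longrightarrow> z \<noteq> w \<Longrightarrow> norm (z + w) \<le> 2 - c"
    using roots_of_unity_gap[OF P] by blast
  define Q where "Q = insert 1 (p ` {w \<in> words (window_length + n). 0 < p w})"
  have fQ: "finite Q" by (simp add: Q_def)
  define q0 where "q0 = Min Q"
  have q0: "q0 > 0" unfolding q0_def using fQ by (subst Min_gr_iff) (auto simp: Q_def)
  have q0_le: "q0 \<le> p w" if "w \<in> words (window_length + n)" "0 < p w" for w
    unfolding q0_def using that fQ by (intro Min_le) (auto simp: Q_def)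
  show thesis
  proof (rule that[of "max 0 (1 - q0 * c)"])
    show "max 0 (1 - q0 * c) < 1" using q0 c by simp
    fix e :: "int \<Rightarrow> 'a \<Rightarrow> complex" and a and y y' :: "'b list"
    assume e: "\<And>k x. e k x ^ P = 1" and inj: "inj (e (a + int window_offset))"
      and triv: "\<And>i. window_offset < i \<Longrightarrow> i < window_length \<Longrightarrow> e (a + int i) = (\<lambda>_. 1)"
      and y: "length y = n" "length y' = n"
    let ?V = "words (window_length - n) :: 'b list set" and ?q = "\<lambda>v. p (y @ v @ y')"
      and ?g = "\<lambda>v. phase e a (y @ v @ y')"
    have e1: "norm (e k x) = 1" for k x
    proof -
      have "norm (e k x) ^ P = 1 ^ P" using e by (simp flip: norm_power)
      then show ?thesis using P power_eq_imp_eq_base[of "norm (e k x)" P 1] by simp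
    qed
    show "norm (\<Sum>v\<in>?V. ?q v * ?g v) \<le> max 0 (1 - q0 * c) * (\<Sum>v\<in>?V. ?q v)"
    proof (cases "0 < p y \<and> 0 < p y'")
      case True
      obtain v1 v2 where v: "v1 \<in> ?V" "v2 \<in> ?V" "0 < ?q v1" "0 < ?q v2" "?g v1 \<noteq> ?g v2"
        using phase_varies[of e a y y'] e1 inj triv y True by (metis norm_zero zero_neq_one)
      have root: "?g v ^ P = 1" for v
        by (simp only: phase_def prod_power_distrib e prod.neutral_const)
      have W: "n \<le> window_length" by (simp add: window_length_def)
      have "norm (\<Sum>v\<in>?V. ?q v * ?g v) \<le> (\<Sum>v\<in>?V. ?q v) - q0 * c"
      proof (rule norm_weighted_sum_gap)
        show "v1 \<noteq> v2" using v by auto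
        show "norm (?g v1 + ?g v2) \<le> 2 - c" using c(2)[OF root root v(5)] .
        show "norm (?g v) = 1" for v using e1 by (rule norm_phase)
        show "q0 \<le> ?q v1" "q0 \<le> ?q v2"
          using v y W by (auto intro!: q0_le simp: words_def)
      qed (use v q0 nonneg in auto)
      also have "(\<Sum>v\<in>?V. ?q v) \<le> 1"
      proof -
        have "(\<Sum>v\<in>?V. ?q v) \<le> (\<Sum>v\<in>?V. p (y @ v))"
          by (intro sum_mono) (metis append.assoc append_right_le)
        also have "\<dots> \<le> 1" using append_right_le[of "[]" y] by (simp add: sum_append_right nil)
        finally show ?thesis .
      qed
      then have "(\<Sum>v\<in>?V. ?q v) - q0 * c \<le> (1 - q0 * c) * (\<Sum>v\<in>?V. ?q v)"
        using q0 c mult_left_mono[of "(\<Sum>v\<in>?V. ?q v)" 1 "q0 * c"] by (simp add: algebra_simps)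
      also have "\<dots> \<le> max 0 (1 - q0 * c) * (\<Sum>v\<in>?V. ?q v)"
        by (intro mult_right_mono sum_nonneg nonneg) simp
      finally show ?thesis .
    next
      case False
      have "?q v = 0" for v
      proof (rule ccontr)
        assume "?q v \<noteq> 0"
        then have pos: "0 < ?q v" using nonneg[of "y @ v @ y'"] by simp
        then have "0 < p y" by (rule pos_leftD)
        moreover have "0 < p y'" using pos pos_rightD[of "y @ v" y'] by simp
        ultimately show False using False by simp
      qed
      then show ?thesis by simp
    qed
  qed simp
qed

section \<open>Decay of character sums along a chain\<close>

text \<open>
  The integral of the character over the first \<open>T\<close> coordinates, restricted to the event that the
  next word is \<open>y\<close>, is at most \<open>q\<close> times the probability of this event.  Keeping the end word is
  what allows the estimate to be propagated by the Markov property.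
\<close>

definition damped :: "(int \<Rightarrow> 'a \<Rightarrow> complex) \<Rightarrow> int \<Rightarrow> nat \<Rightarrow> real \<Rightarrow> bool" where
  "damped e a T q \<longleftrightarrow> (\<forall>y\<in>words n. norm (\<Sum>u\<in>words T. p (u @ y) * phase e a (u @ y)) \<le> q * p y)"

lemma damped_0: "damped e a 0 1"
  by (simp add: damped_def phase_def words_def nonneg)

text \<open>
  The Markov property for character sums: given \<open>y\<close>, summing over the past commutes with appending
  a future \<open>v\<close>.
\<close>

lemma sum_past:
  assumes "length y = n"
  shows "p y * (\<Sum>u\<in>words T. p (u @ y @ v) * phase e a (u @ y @ v))
      = p (y @ v) * phase e (a + int T) (y @ v) * (\<Sum>u\<in>words T. p (u @ y) * phase e a (u @ y))"
proof -
  have "p y * (p (u @ y @ v) * phase e a (u @ y @ v))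
      = p (y @ v) * phase e (a + int T) (y @ v) * (p (u @ y) * phase e a (u @ y))"
    if "u \<in> words T" for u
  proof -
    have "complex_of_real (p (u @ y @ v)) * p y = p (u @ y) * p (y @ v)"
      using markov[OF assms, of u v] by (simp flip: of_real_mult)
    then show ?thesis
      using that phase_append[OF assms, of e a u v] by (simp add: words_def mult_ac)
  qed
  then show ?thesis by (simp add: sum_distrib_left cong: sum.cong)
qed

text \<open>
  The number \<open>s\<close> is the conditional expectation of the character over the past given \<open>y\<close>.
\<close>

lemma damped_past:
  assumes "damped e a T q" "length y = n" "0 \<le> q"
  obtains s where "norm s \<le> q"
    "\<And>v. (\<Sum>u\<in>words T. p (u @ y @ v) * phase e a (u @ y @ v))
      = s * (p (y @ v) * phase e (a + int T) (y @ v))"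
proof (cases "p y = 0")
  case True
  have "p (y @ v) = 0" for v using append_right_le[of y v] nonneg[of "y @ v"] True by simp
  moreover have "p (u @ y @ v) = 0" for u v
    using append_left_le[of u "y @ v"] nonneg[of "u @ y @ v"] calculation[of v] by simp
  ultimately show ?thesis using that[of 0] assms by simp
next
  case False
  then have py: "0 < p y" using nonneg[of y] by simp
  define s where "s = (\<Sum>u\<in>words T. p (u @ y) * phase e a (u @ y)) / p y"
  show ?thesis
  proof (rule that[of s])
    have "norm s = norm (\<Sum>u\<in>words T. p (u @ y) * phase e a (u @ y)) / p y"
      using py by (simp add: s_def norm_divide)
    also have "\<dots> \<le> q"
      using assms py by (simp add: damped_def words_def divide_le_eq)
    finally show "norm s \<le> q" .
    show "(\<Sum>u\<in>words T. p (u @ y @ v) * phase e a (u @ y @ v))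
      = s * (p (y @ v) * phase e (a + int T) (y @ v))" for v
      using sum_past[OF assms(2), where T = T and v = v and e = e and a = a] py by (simp add: s_def field_simps)
  qed
qed

text \<open>
  Appending coordinates multiplies by unimodular factors, which can only be estimated trivially.
  The first \<open>n\<close> letters of \<open>x @ y'\<close> serve as the end word, whatever the length of \<open>x\<close>.
\<close>

lemma damped_mono_length:
  assumes d: "damped e a T q" "0 \<le> q" and e: "\<And>k x. norm (e k x) = 1" and "T \<le> T'"
  shows "damped e a T' q"
  unfolding damped_def
proof
  fix y' :: "'b list" assume "y' \<in> words n"
  then have y': "length y' = n" by (simp add: words_def)
  define m where "m = T' - T"
  let ?f = "\<lambda>w. p w * phase e a w"
  have bound: "norm (\<Sum>u\<in>words T. ?f (u @ x @ y')) \<le> q * p (x @ y')" for x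
  proof -
    define y where "y = take n (x @ y')"
    define v where "v = drop n (x @ y')"
    have yv: "x @ y' = y @ v" "length y = n" using y' by (simp_all only: y_def v_def append_take_drop_id) simp
    obtain s where s: "norm s \<le> q" "(\<Sum>u\<in>words T. ?f (u @ y @ v)) = s * (p (y @ v) * phase e (a + int T) (y @ v))"
      by (rule damped_past[OF d(1) yv(2) d(2)]) blast
    then have "norm (\<Sum>u\<in>words T. ?f (u @ y @ v)) \<le> q * p (y @ v)"
      using norm_phase[of e "a + int T" "y @ v", OF e] nonneg
      by (simp add: norm_mult mult_right_mono)
    then show ?thesis by (simp add: yv)
  qed
  have "(\<Sum>u\<in>words T'. ?f (u @ y')) = (\<Sum>u\<in>words T. \<Sum>x\<in>words m. ?f (u @ x @ y'))"
    using sum_words_add[of "\<lambda>u. ?f (u @ y')" T m] \<open>T \<le> T'\<close> by (simp add: m_def)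
  also have "\<dots> = (\<Sum>x\<in>words m. \<Sum>u\<in>words T. ?f (u @ x @ y'))"
    by (rule sum.swap)
  also have "norm \<dots> \<le> (\<Sum>x\<in>words m. q * p (x @ y'))"
    using bound by (rule sum_norm_le)
  also have "\<dots> = q * p y'"
    by (simp add: sum_append_left flip: sum_distrib_left)
  finally show "norm (\<Sum>u\<in>words T'. ?f (u @ y')) \<le> q * p y'" .
qed

text \<open>
  A window whose conditional sums are damped by \<open>r\<close>, uniformly in its end words, contributes the
  factor \<open>r\<close>.
\<close>

lemma damped_window:
  assumes d: "damped e a T q" "0 \<le> q"
    and r: "\<And>y y'. length y = n \<Longrightarrow> length y' = n \<Longrightarrow>
       norm (\<Sum>v\<in>words l. p (y @ v @ y') * phase e (a + int T) (y @ v @ y')) \<le> r * (\<Sum>v\<in>words l. p (y @ v @ y'))"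
  shows "damped e a (T + (n + l)) (q * r)"
  unfolding damped_def
proof
  fix y' :: "'b list" assume "y' \<in> words n"
  then have y': "length y' = n" by (simp add: words_def)
  let ?f = "\<lambda>w. p w * phase e a w"
  have bound: "norm (\<Sum>v\<in>words l. \<Sum>u\<in>words T. ?f (u @ y @ v @ y')) \<le> q * r * (\<Sum>v\<in>words l. p (y @ v @ y'))"
    if y: "y \<in> words n" for y
  proof -
    have y: "length y = n" using y by (simp add: words_def)
    obtain s where s: "norm s \<le> q"
      "\<And>v. (\<Sum>u\<in>words T. ?f (u @ y @ v)) = s * (p (y @ v) * phase e (a + int T) (y @ v))"
      by (rule damped_past[OF d(1) y d(2)]) blast
    have "norm (\<Sum>v\<in>words l. \<Sum>u\<in>words T. ?f (u @ y @ v @ y'))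
        = norm s * norm (\<Sum>v\<in>words l. p (y @ v @ y') * phase e (a + int T) (y @ v @ y'))"
      by (simp add: s(2) norm_mult flip: sum_distrib_left)
    also have "\<dots> \<le> q * (r * (\<Sum>v\<in>words l. p (y @ v @ y')))"
      using s(1) r[OF y y'] d(2) by (intro mult_mono) auto
    finally show ?thesis by simp
  qed
  have "(\<Sum>u\<in>words (T + (n + l)). ?f (u @ y'))
      = (\<Sum>u\<in>words T. \<Sum>y\<in>words n. \<Sum>v\<in>words l. ?f (u @ y @ v @ y'))"
    by (simp add: sum_words_add)
  also have "\<dots> = (\<Sum>y\<in>words n. \<Sum>v\<in>words l. \<Sum>u\<in>words T. ?f (u @ y @ v @ y'))"
    by (rule trans[OF sum.swap sum.cong[OF refl sum.swap]])
  also have "norm \<dots> \<le> (\<Sum>y\<in>words n. q * r * (\<Sum>v\<in>words l. p (y @ v @ y')))"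
    using bound by (rule sum_norm_le)
  also have "\<dots> = q * r * (\<Sum>x\<in>words (n + l). p (x @ y'))"
    by (simp add: sum_words_add flip: sum_distrib_left)
  also have "\<dots> = q * r * p y'" by (simp only: sum_append_left)
  finally show "norm (\<Sum>u\<in>words (T + (n + l)). ?f (u @ y')) \<le> q * r * p y'" .
qed

text \<open>
  Induction on the marked coordinates from left to right.  The gap of length \<open>window_length\<close> after
  each of them keeps the windows disjoint: the window of the next one starts no earlier than the
  previous window ends.
\<close>

lemma character_sum_decay:
  assumes P: "P > 0"
  obtains \<rho> where "0 \<le> \<rho>" "\<rho> < 1"
    "\<And>e G a T. (\<And>k x. e k x ^ P = 1) \<Longrightarrow> finite G \<Longrightarrow> (\<And>k. k \<in> G \<Longrightarrow> inj (e k)) \<Longrightarrow>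
       (\<And>k i. k \<in> G \<Longrightarrow> k < i \<Longrightarrow> i < k + int window_length \<Longrightarrow> e i = (\<lambda>_. 1)) \<Longrightarrow>
       (\<And>k. k \<in> G \<Longrightarrow> a + int window_offset \<le> k \<and> k + int (n + M) \<le> a + int T) \<Longrightarrow>
       norm (\<Sum>w\<in>words (T + n). p w * phase e a w) \<le> \<rho> ^ card G"
proof -
  obtain \<rho> where \<rho>: "0 \<le> \<rho>" "\<rho> < 1"
    and gap: "\<And>e a y y'. (\<And>k x. e k x ^ P = 1) \<Longrightarrow> inj (e (a + int window_offset)) \<Longrightarrow>
       (\<And>i. window_offset < i \<Longrightarrow> i < window_length \<Longrightarrow> e (a + int i) = (\<lambda>_. 1)) \<Longrightarrow>
       length y = n \<Longrightarrow> length y' = n \<Longrightarrow>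
       norm (\<Sum>v\<in>words (window_length - n). p (y @ v @ y') * phase e a (y @ v @ y'))
         \<le> \<rho> * (\<Sum>v\<in>words (window_length - n). p (y @ v @ y'))"
    by (rule spectral_gap[OF P]) blast
  show thesis
  proof (rule that[OF \<rho>])
    fix e :: "int \<Rightarrow> 'a \<Rightarrow> complex" and G a T
    assume e: "\<And>k x. e k x ^ P = 1" and "finite G" and "\<And>k. k \<in> G \<Longrightarrow> inj (e k)"
      and "\<And>k i. k \<in> G \<Longrightarrow> k < i \<Longrightarrow> i < k + int window_length \<Longrightarrow> e i = (\<lambda>_. 1)"
      and "\<And>k. k \<in> G \<Longrightarrow> a + int window_offset \<le> k \<and> k + int (n + M) \<le> a + int T"
    have e1: "norm (e k x) = 1" for k x
    proof -
      have "norm (e k x) ^ P = 1 ^ P" using e by (simp flip: norm_power)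
      then show ?thesis using P power_eq_imp_eq_base[of "norm (e k x)" P 1] by simp
    qed
    have "damped e a T (\<rho> ^ card G)"
      using \<open>finite G\<close> \<open>\<And>k. k \<in> G \<Longrightarrow> inj (e k)\<close>
        \<open>\<And>k i. k \<in> G \<Longrightarrow> k < i \<Longrightarrow> i < k + int window_length \<Longrightarrow> e i = (\<lambda>_. 1)\<close>
        \<open>\<And>k. k \<in> G \<Longrightarrow> a + int window_offset \<le> k \<and> k + int (n + M) \<le> a + int T\<close>
    proof (induction G arbitrary: T rule: finite_linorder_max_induct)
      case empty
      then show ?case using damped_mono_length[OF damped_0[of e a], of T] e1 by simp
    next
      case (insert b G)
      define T0 where "T0 = nat (b - int window_offset - a)"
      have T0: "a + int T0 + int window_offset = b" using insert.prems(3)[of b] by (simp add: T0_def)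
      have sp: "window_length = window_offset + (n + M)" by (simp add: window_length_def window_offset_def)
      have before: "damped e a T0 (\<rho> ^ card G)"
      proof (rule insert.IH)
        fix k assume k: "k \<in> G"
        \<comment> \<open>Otherwise \<open>e b\<close> would be trivial and injective, leaving a single symbol.\<close>
        have "\<not> b < k + int window_length"
        proof
          assume "b < k + int window_length"
          then have "e b = (\<lambda>_. 1)" using insert.prems(2)[of k b] k insert.hyps by auto
          then have "\<psi> x = \<psi> y" for x y
            using insert.prems(1)[of b] by (auto simp: inj_def)
          then show False using nonconst by blast
        qed
        then show "a + int window_offset \<le> k \<and> k + int (n + M) \<le> a + int T0"
          using T0 insert.prems(3)[of k] k by (auto simp: sp)
      qed (use insert.prems in auto)
      have step: "damped e a (T0 + (n + (window_length - n))) (\<rho> ^ card G * \<rho>)"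
      proof (rule damped_window[OF before])
        show "0 \<le> \<rho> ^ card G" using \<rho> by simp
        fix y y' :: "'b list" assume y: "length y = n" "length y' = n"
        show "norm (\<Sum>v\<in>words (window_length - n). p (y @ v @ y') * phase e (a + int T0) (y @ v @ y'))
           \<le> \<rho> * (\<Sum>v\<in>words (window_length - n). p (y @ v @ y'))"
        proof (rule gap[OF e _ _ y])
          show "inj (e (a + int T0 + int window_offset))" using insert.prems(1)[of b] T0 by simp
          show "e (a + int T0 + int i) = (\<lambda>_. 1)" if "window_offset < i" "i < window_length" for i
            using insert.prems(2)[of b "a + int T0 + int i"] that T0 by simp
        qed
      qed
      have "damped e a (T0 + window_length) (\<rho> ^ card (insert b G))"
      proof -
        have "b \<notin> G" using insert.hyps by auto
        then show ?thesis
          using step insert.hyps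
          by (simp add: window_length_def mult.commute)
      qed
      moreover have "T0 + window_length \<le> T"
      proof -
        have "b + int (n + M) \<le> a + int T" using insert.prems(3)[of b] by simp
        then have "int (T0 + window_length) \<le> int T" using T0 by (simp add: sp)
        then show ?thesis by (simp only: of_nat_le_iff)
      qed
      moreover have "0 \<le> \<rho> ^ card (insert b G)" using \<rho>(1) by (rule zero_le_power)
      ultimately show ?case using e1 damped_mono_length by blast
    qed
    then have "norm (\<Sum>u\<in>words T. p (u @ y) * phase e a (u @ y)) \<le> \<rho> ^ card G * p y"
      if "y \<in> words n" for y using that by (simp add: damped_def)
    then have "norm (\<Sum>y\<in>words n. \<Sum>u\<in>words T. p (u @ y) * phase e a (u @ y)) \<le> (\<Sum>y\<in>words n. \<rho> ^ card G * p y)"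
      by (rule sum_norm_le)
    also have "\<dots> = \<rho> ^ card G" by (simp add: sum_words flip: sum_distrib_left)
    finally show "norm (\<Sum>w\<in>words (T + n). p w * phase e a w) \<le> \<rho> ^ card G"
      by (simp add: sum_words_add sum.swap[of _ "words T"])
  qed
qed

end

section \<open>The topology of configuration spaces\<close>

lemma topspace_config [simp]: "topspace config_topology = UNIV"
  by (simp add: config_topology_def)

lemma compact_config: "compact_space (config_topology :: (int \<Rightarrow> 'a::finite) topology)"
  by (simp add: config_topology_def compact_space_product_topology compact_space_discrete_topology)

lemma openin_config:
  "openin config_topology U \<longleftrightarrow>
     (\<forall>b\<in>U. \<exists>F. finite F \<and> (\<forall>b'. (\<forall>i\<in>F. b' i = b i) \<longrightarrow> b' \<in> U))" (is "?L \<longleftrightarrow> ?R")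
proof
  assume L: ?L
  show ?R
  proof
    fix b assume "b \<in> U"
    then obtain V where V: "finite {i. V i \<noteq> UNIV}" "b \<in> Pi\<^sub>E UNIV V" "Pi\<^sub>E UNIV V \<subseteq> U"
      using L unfolding config_topology_def openin_product_topology_alt by auto
    have "b' \<in> U" if "\<forall>i\<in>{i. V i \<noteq> UNIV}. b' i = b i" for b'
    proof -
      have "b' i \<in> V i" for i using that V(2) by (cases "V i = UNIV") (auto simp: PiE_iff)
      then show ?thesis using V(3) by (auto simp: PiE_iff)
    qed
    then show "\<exists>F. finite F \<and> (\<forall>b'. (\<forall>i\<in>F. b' i = b i) \<longrightarrow> b' \<in> U)" using V(1) by blast
  qed
next
  assume R: ?R
  show ?L
    unfolding config_topology_def openin_product_topology_alt
  proof
    fix b assume "b \<in> U"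
    then obtain F where F: "finite F" "\<And>b'. (\<forall>i\<in>F. b' i = b i) \<Longrightarrow> b' \<in> U" using R by blast
    show "\<exists>V. finite {i \<in> UNIV. V i \<noteq> topspace (discrete_topology UNIV)} \<and>
        (\<forall>i\<in>UNIV. openin (discrete_topology UNIV) (V i)) \<and> b \<in> Pi\<^sub>E UNIV V \<and> Pi\<^sub>E UNIV V \<subseteq> U"
      using F by (intro exI[of _ "\<lambda>i. if i \<in> F then {b i} else UNIV"])
        (auto simp: PiE_iff intro: finite_subset[of _ F] split: if_splits)
  qed
qed

text \<open>
  Compactness: a property that holds locally for all pairs of configurations holds for all pairs
  agreeing on one sufficiently large window.  Uniform continuity, the finite range of block maps and
  the finite support of characters are all instances.
\<close>

lemma uniform_window:
  fixes P :: "(int \<Rightarrow> 'a::finite) \<Rightarrow> (int \<Rightarrow> 'a) \<Rightarrow> bool"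
  assumes "\<And>b. \<exists>U. openin config_topology U \<and> b \<in> U \<and> (\<forall>b'\<in>U. \<forall>b''\<in>U. P b' b'')"
  obtains r :: nat where "\<And>b b'. (\<And>i. \<bar>i\<bar> \<le> int r \<Longrightarrow> b i = b' i) \<Longrightarrow> P b b'"
proof -
  have "\<exists>F. finite F \<and> (\<forall>b'. (\<forall>i\<in>F. b' i = b i) \<longrightarrow> (\<forall>b''. (\<forall>i\<in>F. b'' i = b i) \<longrightarrow> P b' b''))" for b
    using assms[of b] unfolding openin_config by metis
  then obtain F where F: "\<And>b. finite (F b)"
    "\<And>b b' b''. (\<forall>i\<in>F b. b' i = b i) \<Longrightarrow> (\<forall>i\<in>F b. b'' i = b i) \<Longrightarrow> P b' b''" by metis
  define N where "N b = {b'. \<forall>i\<in>F b. b' i = b i}" for b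
  have "openin config_topology (N b)" for b
    unfolding openin_config N_def using F(1) by (intro ballI exI[of _ "F b"]) auto
  moreover have "\<Union> (range N) = UNIV" by (auto simp: N_def)
  ultimately obtain \<F> where "finite \<F>" "\<F> \<subseteq> range N" "\<Union>\<F> = UNIV"
    using compact_config[unfolded compact_space, rule_format, of "range N"] by auto
  then obtain B where B: "finite B" "(\<Union>b\<in>B. N b) = UNIV"
    by (metis finite_subset_image)
  define A where "A = (\<Union>b\<in>B. F b)"
  have A: "finite A" using B F by (simp add: A_def)
  define r where "r = nat (Max (insert 0 (abs ` A)))"
  have r: "\<bar>i\<bar> \<le> int r" if "i \<in> A" for i
    using that A by (simp add: r_def)
  show thesis
  proof (rule that)
    fix b b' :: "int \<Rightarrow> 'a" assume eq: "\<And>i. \<bar>i\<bar> \<le> int r \<Longrightarrow> b i = b' i"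
    obtain c where c: "c \<in> B" "b \<in> N c" using B by blast
    have "b' i = c i" if "i \<in> F c" for i
    proof -
      have "i \<in> A" using that c by (auto simp: A_def)
      then have "b i = b' i" by (intro eq r)
      then show ?thesis using c(2) that by (simp add: N_def)
    qed
    then show "P b b'" using c F(2)[of c b b'] by (auto simp: N_def)
  qed
qed

lemma continuous_window:
  fixes h :: "(int \<Rightarrow> 'a::finite) \<Rightarrow> 'c::metric_space"
  assumes "continuous_map config_topology euclidean h" "\<epsilon> > 0"
  obtains r :: nat where "\<And>b b'. (\<And>i. \<bar>i\<bar> \<le> int r \<Longrightarrow> b i = b' i) \<Longrightarrow> dist (h b) (h b') < \<epsilon>"
proof (rule uniform_window[where P = "\<lambda>b b'. dist (h b) (h b') < \<epsilon>"])
  fix b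
  have "openin config_topology {x \<in> topspace config_topology. h x \<in> ball (h b) (\<epsilon> / 2)}"
    using assms(1) by (rule openin_continuous_map_preimage) simp
  then show "\<exists>U. openin config_topology U \<and> b \<in> U \<and> (\<forall>b'\<in>U. \<forall>b''\<in>U. dist (h b') (h b'') < \<epsilon>)"
    using assms(2) by (intro exI[of _ "{x. dist (h b) (h x) < \<epsilon> / 2}"])
      (auto intro: dist_triangle_half_r)
qed (erule that)

lemma coordinate_window:
  fixes F :: "(int \<Rightarrow> 'a::finite) \<Rightarrow> (int \<Rightarrow> 'c)"
  assumes "continuous_map config_topology config_topology F"
  obtains r :: nat where "\<And>b b'. (\<And>i. \<bar>i\<bar> \<le> int r \<Longrightarrow> b i = b' i) \<Longrightarrow> F b k = F b' k"
proof (rule uniform_window[where P = "\<lambda>b b'. F b k = F b' k"])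
  fix b
  have "openin config_topology {c. c k = F b k}"
    unfolding openin_config by (intro ballI exI[of _ "{k}"]) auto
  then have "openin config_topology {x \<in> topspace config_topology. F x \<in> {c. c k = F b k}}"
    using assms by (rule openin_continuous_map_preimage[rotated])
  then show "\<exists>U. openin config_topology U \<and> b \<in> U \<and> (\<forall>b'\<in>U. \<forall>b''\<in>U. F b' k = F b'' k)"
    by (intro exI[of _ "{x. F x k = F b k}"]) auto
qed (erule that)

lemma continuous_mapI_window:
  fixes F :: "(int \<Rightarrow> 'b) \<Rightarrow> (int \<Rightarrow> 'c)"
  assumes "\<And>k. \<exists>K. finite K \<and> (\<forall>b b'. (\<forall>i\<in>K. b i = b' i) \<longrightarrow> F b k = F b' k)"
  shows "continuous_map config_topology config_topology F"
  unfolding continuous_map_def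
proof (intro conjI allI impI)
  fix U :: "(int \<Rightarrow> 'c) set" assume U: "openin config_topology U"
  obtain K where K: "\<And>k. finite (K k)" "\<And>k b b'. (\<forall>i\<in>K k. b i = b' i) \<Longrightarrow> F b k = F b' k"
    using assms by metis
  show "openin config_topology {x \<in> topspace config_topology. F x \<in> U}"
    unfolding openin_config
  proof
    fix b assume "b \<in> {x \<in> topspace config_topology. F x \<in> U}"
    then obtain G where G: "finite G" "\<And>c. (\<forall>i\<in>G. c i = F b i) \<Longrightarrow> c \<in> U"
      using U unfolding openin_config by auto
    have "F b' \<in> U" if "\<forall>i\<in>(\<Union>k\<in>G. K k). b' i = b i" for b'
    proof (rule G(2), rule ballI)
      fix k assume "k \<in> G"
      then show "F b' k = F b k" using that by (intro K(2)) auto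
    qed
    then show "\<exists>F'. finite F' \<and> (\<forall>b'. (\<forall>i\<in>F'. b' i = b i) \<longrightarrow> b' \<in> {x \<in> topspace config_topology. F x \<in> U})"
      using G(1) K(1) by (intro exI[of _ "\<Union>k\<in>G. K k"]) auto
  qed
qed auto

lemma continuous_windowI:
  fixes h :: "(int \<Rightarrow> 'b) \<Rightarrow> 'c::topological_space"
  assumes "finite K" "\<And>b b'. (\<And>i. i \<in> K \<Longrightarrow> b i = b' i) \<Longrightarrow> h b = h b'"
  shows "continuous_map config_topology euclidean h"
  unfolding continuous_map_def
proof (intro conjI allI impI)
  fix U :: "'c set"
  show "openin config_topology {x \<in> topspace config_topology. h x \<in> U}"
    unfolding openin_config
  proof
    fix b assume b: "b \<in> {x \<in> topspace config_topology. h x \<in> U}"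
    have "h b' \<in> U" if "\<forall>i\<in>K. b' i = b i" for b'
      using assms(2)[of b' b] that b by simp
    then show "\<exists>F. finite F \<and> (\<forall>b'. (\<forall>i\<in>F. b' i = b i) \<longrightarrow> b' \<in> {x \<in> topspace config_topology. h x \<in> U})"
      using assms(1) by (intro exI[of _ K]) auto
  qed
qed auto

section \<open>Cylinders and local functions\<close>

lemma length_block [simp]: "length (block b k m) = m"
  by (simp add: block_def)

lemma nth_block [simp]: "i < m \<Longrightarrow> block b k m ! i = b (k + int i)"
  by (simp add: block_def)

lemma block_add: "block b k (m + l) = block b k m @ block b (k + int m) l"
  by (rule nth_equalityI) (auto simp: nth_append)

lemma block_shift: "block (config_shift v b) k m = block b (k - v) m"
  by (simp add: block_def config_shift_def algebra_simps)

lemma mem_cylinder: "b \<in> cylinder k w \<longleftrightarrow> (\<forall>i<length w. b (k + int i) = w ! i)"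
  unfolding cylinder_def by (auto simp: list_eq_iff_nth_eq)

lemma cylinder_append: "cylinder k (u @ v) = cylinder k u \<inter> cylinder (k + int (length u)) v"
  by (auto simp: cylinder_def block_add)

lemma space_config [simp]: "space config_space = UNIV"
  by (simp add: config_space_def space_PiM)

lemma measurable_coordinate [measurable]: "(\<lambda>b. b k) \<in> measurable config_space (count_space UNIV)"
  unfolding config_space_def by (rule measurable_component_singleton) simp

lemma cylinder_sets: "cylinder k w \<in> sets config_space"
proof -
  have "cylinder k w = {b \<in> space config_space. \<forall>i\<in>{..<length w}. b (k + int i) = w ! i}"
    by (auto simp: mem_cylinder)
  also have "\<dots> \<in> sets config_space"
  proof (rule sets.sets_Collect_finite_All)
    fix i
    have "(\<lambda>b. b (k + int i)) -` {w ! i} \<inter> space config_space \<in> sets config_space"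
      by (rule measurable_sets[OF measurable_coordinate]) simp
    then show "{b \<in> space config_space. b (k + int i) = w ! i} \<in> sets config_space"
      by (simp add: vimage_def Int_def conj_commute)
  qed simp
  finally show ?thesis .
qed

lemma measurable_block [measurable]:
  "(\<lambda>b :: int \<Rightarrow> 'b::finite. block b k m) \<in> measurable config_space (count_space UNIV)"
proof (subst measurable_count_space_eq_countable, simp, intro conjI ballI)
  fix w :: "'b list"
  have "(\<lambda>b. block b k m) -` {w} \<inter> space config_space = (if length w = m then cylinder k w else {})"
    by (auto simp: cylinder_def)
  then show "(\<lambda>b. block b k m) -` {w} \<inter> space config_space \<in> sets config_space"
    by (auto simp: cylinder_sets)
qed auto

text \<open>
  A configuration with the word \<open>w\<close> at \<open>k\<close>.  Elsewhere its entries are unspecified values of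
  \<open>(!)\<close>; \<open>unblock\<close> is applied only where the entries inside the block matter.
\<close>

definition unblock :: "int \<Rightarrow> 'b list \<Rightarrow> (int \<Rightarrow> 'b)" where
  "unblock k w = (\<lambda>i. w ! nat (i - k))"

lemma factor_block:
  assumes "\<And>b b'. (\<And>i. \<bar>i\<bar> \<le> int r \<Longrightarrow> b i = b' i) \<Longrightarrow> f b = f b'"
  shows "f b = f (unblock (- int r) (block b (- int r) (2 * r + 1)))"
  by (rule assms) (auto simp: unblock_def)

lemma measurable_window:
  fixes f :: "(int \<Rightarrow> 'b::finite) \<Rightarrow> 'c"
  assumes "\<And>b b'. (\<And>i. \<bar>i\<bar> \<le> int r \<Longrightarrow> b i = b' i) \<Longrightarrow> f b = f b'"
  shows "f \<in> measurable config_space (count_space UNIV)"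
proof -
  have eq: "f = (\<lambda>b. f (unblock (- int r) (block b (- int r) (2 * r + 1))))"
    using factor_block[of r f] assms by blast
  show ?thesis
    by (subst eq, rule measurable_compose[OF measurable_block]) simp
qed

lemma measurable_continuous_config:
  fixes F :: "(int \<Rightarrow> 'b::finite) \<Rightarrow> (int \<Rightarrow> 'c)"
  assumes "continuous_map config_topology config_topology F"
  shows "F \<in> measurable config_space config_space"
proof -
  have "F \<in> measurable config_space (\<Pi>\<^sub>M _\<in>UNIV. count_space UNIV)"
  proof (rule measurable_PiM_single')
    fix k
    obtain r :: nat where "\<And>b b'. (\<And>i. \<bar>i\<bar> \<le> int r \<Longrightarrow> b i = b' i) \<Longrightarrow> F b k = F b' k"
      using coordinate_window[OF assms, of k] by blast
    then show "(\<lambda>b. F b k) \<in> measurable config_space (count_space UNIV)"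
      by (rule measurable_window)
  qed auto
  then show ?thesis by (simp add: config_space_def)
qed

text \<open>
  A continuous function is a limit of functions of blocks, and these are measurable into the
  discrete space.
\<close>

lemma borel_measurable_continuous_config:
  fixes h :: "(int \<Rightarrow> 'b::finite) \<Rightarrow> 'c::{second_countable_topology, metric_space}"
  assumes "continuous_map config_topology euclidean h"
  shows "h \<in> borel_measurable config_space"
proof -
  have "\<exists>r::nat. \<forall>b b'. (\<forall>i. \<bar>i\<bar> \<le> int r \<longrightarrow> b i = b' i) \<longrightarrow> dist (h b) (h b') < 1 / Suc m" for m
    using continuous_window[OF assms, of "1 / Suc m"] by (metis divide_pos_pos of_nat_0_less_iff zero_less_Suc zero_less_one)
  then obtain r :: "nat \<Rightarrow> nat" where r: "\<And>m b b'. (\<forall>i. \<bar>i\<bar> \<le> int (r m) \<longrightarrow> b i = b' i) \<Longrightarrow> dist (h b) (h b') < 1 / Suc m"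
    by metis
  define g where "g m b = h (unblock (- int (r m)) (block b (- int (r m)) (2 * r m + 1)))" for m b
  show ?thesis
  proof (rule borel_measurable_LIMSEQ_metric)
    fix m
    have "(\<lambda>b. h (unblock (- int (r m)) (block b (- int (r m)) (2 * r m + 1)))) \<in> borel_measurable config_space"
      by (rule measurable_compose[OF measurable_block]) simp
    then show "g m \<in> borel_measurable config_space" by (simp add: g_def[abs_def])
  next
    fix b
    have "dist (g m b) (h b) < 1 / Suc m" for m
      unfolding g_def by (rule r) (auto simp: unblock_def)
    then show "(\<lambda>m. g m b) \<longlonglongrightarrow> h b"
      by (intro metric_tendsto_imp_tendsto[OF LIMSEQ_inverse_real_of_nat])
         (auto simp: dist_norm inverse_eq_divide intro!: eventuallyI less_imp_le)
  qed
qed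

lemma integral_block:
  fixes g :: "'b::finite list \<Rightarrow> 'c::{banach, second_countable_topology}"
  assumes "config_prob M"
  shows "(\<integral>b. g (block b k m) \<partial>M) = (\<Sum>w\<in>words m. measure M (cylinder k w) *\<^sub>R g w)"
proof -
  interpret prob_space M using assms by (simp add: config_prob_def)
  have sets: "sets M = sets config_space" using assms by (simp add: config_prob_def)
  then have space: "space M = UNIV" using sets_eq_imp_space_eq by fastforce
  have "g (block b k m) = (\<Sum>w\<in>words m. indicator (cylinder k w) b *\<^sub>R g w)" for b
  proof -
    have "(\<Sum>w\<in>words m. indicator (cylinder k w) b *\<^sub>R g w)
        = (\<Sum>w\<in>words m. if w = block b k m then g w else 0)"
      by (intro sum.cong) (auto simp: words_def cylinder_def)
    then show ?thesis by (simp add: words_def[of m] finite_words[unfolded words_def])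
  qed
  then have "(\<integral>b. g (block b k m) \<partial>M) = (\<integral>b. (\<Sum>w\<in>words m. indicator (cylinder k w) b *\<^sub>R g w) \<partial>M)"
    by (simp cong: Bochner_Integration.integral_cong)
  also have "\<dots> = (\<Sum>w\<in>words m. \<integral>b. indicator (cylinder k w) b *\<^sub>R g w \<partial>M)"
    using sets cylinder_sets
    by (intro Bochner_Integration.integral_sum integrable_scaleR_left)
      (auto simp: integrable_indicator_iff emeasure_eq_measure)
  also have "\<dots> = (\<Sum>w\<in>words m. measure M (cylinder k w) *\<^sub>R g w)"
  proof (intro sum.cong refl)
    fix w
    have "integrable M (indicator (cylinder k w) :: _ \<Rightarrow> real)"
      using sets cylinder_sets by (auto simp: integrable_indicator_iff emeasure_eq_measure)
    then show "(\<integral>b. indicator (cylinder k w) b *\<^sub>R g w \<partial>M) = measure M (cylinder k w) *\<^sub>R g w"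
      using space by (simp add: integral_scaleR_left)
  qed
  finally show ?thesis .
qed

section \<open>Characters and their rank\<close>

lemma character_0: "character T \<theta> \<Longrightarrow> \<theta> 0 = 1"
  unfolding character_def by (metis add_0 mult_cancel_right1 norm_zero zero_neq_one)

lemma of_nat_surj_mod_ring: "\<exists>m. x = (of_nat m :: 'p::prime_card mod_ring)"
proof
  show "x = of_nat (nat (to_int_mod_ring x))"
    unfolding of_nat_of_int_mod_ring o_def
    using range_to_int_mod_ring[where 'a = 'p] by (subst int_nat_eq) (auto simp: set_eq_iff)
qed

lemma alphabet_character_of_nat:
  fixes \<eta> :: "'p::prime_card mod_ring \<Rightarrow> complex"
  assumes "character T \<eta>"
  shows "\<eta> (of_nat m * x) = \<eta> x ^ m"
  using assms character_0[OF assms]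
  by (induction m) (auto simp: character_def algebra_simps)

lemma alphabet_character_root:
  fixes \<eta> :: "'p::prime_card mod_ring \<Rightarrow> complex"
  assumes "character T \<eta>"
  shows "\<eta> x ^ CARD('p) = 1"
  using alphabet_character_of_nat[OF assms, of "CARD('p)" x] character_0[OF assms] by simp

text \<open>
  In \<open>\<int>/p\<int>\<close> every element is a multiple of any given nonzero one, so a character that is trivial
  at one nonzero element is trivial.
\<close>

lemma alphabet_character_inj:
  fixes \<eta> :: "'p::prime_card mod_ring \<Rightarrow> complex"
  assumes "nontrivial_character T \<eta>"
  shows "inj \<eta>"
proof (rule injI, rule ccontr)
  have c: "character T \<eta>" using assms by (simp add: nontrivial_character_def)
  fix x y assume xy: "\<eta> x = \<eta> y" "x \<noteq> y"
  have "\<eta> x = \<eta> (x - y) * \<eta> y" using c unfolding character_def by (metis diff_add_cancel)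
  moreover have "\<eta> y \<noteq> 0" using c unfolding character_def by (metis norm_zero zero_neq_one)
  ultimately have d: "\<eta> (x - y) = 1" using xy by simp
  have "\<eta> z = 1" for z
  proof -
    obtain m where "z / (x - y) = of_nat m" using of_nat_surj_mod_ring by blast
    then have "z = of_nat m * (x - y)" using xy(2) by (simp add: field_simps)
    then show ?thesis using alphabet_character_of_nat[OF c, of m "x - y"] d by simp
  qed
  then show False using assms by (auto simp: nontrivial_character_def)
qed

definition spike :: "int \<Rightarrow> 'a::zero \<Rightarrow> (int \<Rightarrow> 'a)" where
  "spike k x = (\<lambda>m. if m = k then x else 0)"

lemma spike_add: "spike k (x + y) = spike k x + spike k (y :: 'a::ab_group_add)"
  by (auto simp: spike_def)

lemma character_coordinate:
  assumes "character config_topology \<theta>"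
  shows "character (discrete_topology UNIV) (\<lambda>x. \<theta> (spike k x))"
  using assms by (auto simp: character_def spike_add)

text \<open>
  The support of a character, described without reference to its factorization; see
  \<open>char_support_eq_active\<close>.
\<close>

definition active :: "((int \<Rightarrow> 'a::ab_group_add) \<Rightarrow> complex) \<Rightarrow> int set" where
  "active \<theta> = {k. \<exists>x. \<theta> (spike k x) \<noteq> 1}"

lemma character_finite_part:
  assumes "character T \<theta>" "finite K"
  shows "\<theta> (\<lambda>m. if m \<in> K then a m else 0) = (\<Prod>k\<in>K. \<theta> (spike k (a k)))"
  using assms(2)
proof induction
  case empty
  then show ?case using character_0[OF assms(1)] by (simp add: zero_fun_def)
next
  case (insert k K)
  have "(\<lambda>m. if m \<in> insert k K then a m else 0) = spike k (a k) + (\<lambda>m. if m \<in> K then a m else 0)"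
    using insert.hyps by (auto simp: spike_def fun_eq_iff)
  then show ?case using insert assms(1) by (simp add: character_def)
qed

lemma config_character_power:
  fixes \<theta> :: "(int \<Rightarrow> 'p::prime_card mod_ring) \<Rightarrow> complex"
  assumes "character T \<theta>"
  shows "\<theta> (\<lambda>k. of_nat m * a k) = \<theta> a ^ m"
proof (induction m)
  case 0
  then show ?case using character_0[OF assms] by (simp add: zero_fun_def)
next
  case (Suc m)
  have "(\<lambda>k. of_nat (Suc m) * a k) = a + (\<lambda>k. of_nat m * a k)"
    by (auto simp: algebra_simps)
  then show ?case using Suc assms by (simp add: character_def)
qed

text \<open>
  The powers of a nontrivial root of unity sum to zero, so they cannot all lie in the right half
  plane.
\<close>

lemma no_small_subgroup:
  fixes z :: complex
  assumes "P > 0" "z ^ P = 1" "\<And>m. dist (z ^ m) 1 < 1"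
  shows "z = 1"
proof (rule ccontr)
  assume "z \<noteq> 1"
  then have "(\<Sum>m<P. z ^ m) = 0" using assms(2) by (simp add: geometric_sum)
  then have "(\<Sum>m<P. Re (z ^ m)) = 0" by (metis Re_sum zero_complex.sel(1))
  moreover have "0 < (\<Sum>m<P. Re (z ^ m))"
  proof (rule sum_pos)
    fix m
    have "\<bar>Re (z ^ m - 1)\<bar> < 1"
      using assms(3)[of m] abs_Re_le_cmod[of "z ^ m - 1"] by (simp add: dist_norm)
    then show "0 < Re (z ^ m)" by simp
  qed (use assms(1) in auto)
  ultimately show False by simp
qed

text \<open>
  On the subgroup of configurations vanishing on a large window, \<open>\<theta>\<close> takes values near 1 by
  continuity, and these values form a subgroup of the circle.
\<close>

lemma character_window:
  fixes \<theta> :: "(int \<Rightarrow> 'p::prime_card mod_ring) \<Rightarrow> complex"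
  assumes c: "character config_topology \<theta>"
  obtains r :: nat where "\<And>a. (\<And>i. \<bar>i\<bar> \<le> int r \<Longrightarrow> a i = 0) \<Longrightarrow> \<theta> a = 1"
proof -
  have cont: "continuous_map config_topology euclidean \<theta>" using c by (simp add: character_def)
  obtain r :: nat where r: "\<And>b b'. (\<And>i. \<bar>i\<bar> \<le> int r \<Longrightarrow> b i = b' i) \<Longrightarrow> dist (\<theta> b) (\<theta> b') < 1"
    using continuous_window[OF cont, of 1] by auto
  have "\<theta> a = 1" if "\<And>i. \<bar>i\<bar> \<le> int r \<Longrightarrow> a i = 0" for a
  proof (rule no_small_subgroup)
    show "\<theta> a ^ CARD('p) = 1"
      using config_character_power[OF c, of "CARD('p)" a] character_0[OF c] by (simp add: zero_fun_def)
    show "dist (\<theta> a ^ m) 1 < 1" for m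
      using r[of "\<lambda>k. of_nat m * a k" 0] that
      by (simp add: config_character_power[OF c] character_0[OF c])
  qed simp
  then show thesis using that by blast
qed

lemma finite_active:
  fixes \<theta> :: "(int \<Rightarrow> 'p::prime_card mod_ring) \<Rightarrow> complex"
  assumes "character config_topology \<theta>"
  shows "finite (active \<theta>)"
proof -
  obtain r :: nat where r: "\<And>a. (\<And>i. \<bar>i\<bar> \<le> int r \<Longrightarrow> a i = 0) \<Longrightarrow> \<theta> a = 1"
    using character_window[OF assms] by blast
  have "active \<theta> \<subseteq> {- int r..int r}"
  proof
    fix k assume "k \<in> active \<theta>"
    then obtain x where "\<theta> (spike k x) \<noteq> 1" by (auto simp: active_def)
    then have "\<bar>k\<bar> \<le> int r" using r[of "spike k x"] by (force simp: spike_def)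
    then show "k \<in> {- int r..int r}" by auto
  qed
  then show ?thesis by (rule finite_subset) simp
qed

lemma character_eq_prod:
  fixes \<theta> :: "(int \<Rightarrow> 'p::prime_card mod_ring) \<Rightarrow> complex"
  assumes c: "character config_topology \<theta>" and K: "finite K" "active \<theta> \<subseteq> K"
  shows "\<theta> a = (\<Prod>k\<in>K. \<theta> (spike k (a k)))"
proof -
  obtain r :: nat where r: "\<And>a. (\<And>i. \<bar>i\<bar> \<le> int r \<Longrightarrow> a i = 0) \<Longrightarrow> \<theta> a = 1"
    using character_window[OF c] by blast
  define L where "L = K \<union> {- int r..int r}"
  have "a = (\<lambda>m. if m \<in> L then a m else 0) + (\<lambda>m. if m \<in> L then 0 else a m)"
    by (auto simp: fun_eq_iff)
  then have "\<theta> a = \<theta> (\<lambda>m. if m \<in> L then a m else 0) * \<theta> (\<lambda>m. if m \<in> L then 0 else a m)"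
    using c unfolding character_def by metis
  also have "\<theta> (\<lambda>m. if m \<in> L then 0 else a m) = 1" by (rule r) (auto simp: L_def)
  also have "\<theta> (\<lambda>m. if m \<in> L then a m else 0) = (\<Prod>k\<in>L. \<theta> (spike k (a k)))"
    using K by (intro character_finite_part[OF c]) (simp add: L_def)
  also have "\<dots> = (\<Prod>k\<in>K. \<theta> (spike k (a k)))"
    using K by (intro prod.mono_neutral_right) (auto simp: L_def active_def)
  finally show ?thesis by simp
qed

lemma active_eqI:
  fixes \<theta> :: "(int \<Rightarrow> 'a::ab_group_add) \<Rightarrow> complex"
  assumes K: "finite K" and \<psi>: "\<And>k. k \<in> K \<Longrightarrow> nontrivial_character (discrete_topology UNIV) (\<psi> k)"
    and \<theta>: "\<theta> = (\<lambda>a. \<Prod>k\<in>K. \<psi> k (a k))"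
  shows "active \<theta> = K"
proof -
  have *: "\<theta> (spike k x) = (if k \<in> K then \<psi> k x else 1)" for k x
  proof -
    have "\<theta> (spike k x) = (\<Prod>j\<in>K. if j = k then \<psi> k x else 1)"
      unfolding \<theta> using \<psi> character_0 by (intro prod.cong) (auto simp: spike_def nontrivial_character_def)
    then show ?thesis using K by simp
  qed
  show ?thesis
    using \<psi> unfolding active_def * by (auto simp: nontrivial_character_def fun_eq_iff)
qed

lemma char_support_eq_active:
  fixes \<theta> :: "(int \<Rightarrow> 'p::prime_card mod_ring) \<Rightarrow> complex"
  assumes c: "character config_topology \<theta>"
  shows "char_support \<theta> = active \<theta>"
  unfolding char_support_def
proof (rule the_equality)
  have "nontrivial_character (discrete_topology UNIV) (\<lambda>x. \<theta> (spike k x))" if "k \<in> active \<theta>" for k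
    using character_coordinate[OF c, of k] that by (auto simp: nontrivial_character_def active_def fun_eq_iff)
  moreover have "\<theta> = (\<lambda>a. \<Prod>k\<in>active \<theta>. \<theta> (spike k (a k)))"
    using character_eq_prod[OF c finite_active[OF c]] by blast
  ultimately show "finite (active \<theta>) \<and> (\<exists>\<psi>. (\<forall>k\<in>active \<theta>. nontrivial_character (discrete_topology UNIV) (\<psi> k)) \<and>
              \<theta> = (\<lambda>a. \<Prod>k\<in>active \<theta>. \<psi> k (a k)))"
    using finite_active[OF c] by (intro conjI exI[of _ "\<lambda>k x. \<theta> (spike k x)"]) auto
next
  fix K assume "finite K \<and> (\<exists>\<psi>. (\<forall>k\<in>K. nontrivial_character (discrete_topology UNIV) (\<psi> k)) \<and>
              \<theta> = (\<lambda>a. \<Prod>k\<in>K. \<psi> k (a k)))"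
  then show "K = active \<theta>" using active_eqI by metis
qed

lemma active_nonempty:
  fixes \<theta> :: "(int \<Rightarrow> 'p::prime_card mod_ring) \<Rightarrow> complex"
  assumes "nontrivial_character config_topology \<theta>"
  shows "active \<theta> \<noteq> {}"
  using assms character_eq_prod[of \<theta> "{}"] by (auto simp: nontrivial_character_def)

text \<open>
  Take the right end of the support of each factor.  A later coordinate of the total support at
  distance less than \<open>S\<close> can lie neither in the same factor, nor, by separation, in another one.
  The supports of different factors may interleave.
\<close>

lemma separated_factors:
  fixes \<theta> :: "(int \<Rightarrow> 'p::prime_card mod_ring) \<Rightarrow> complex"
  assumes S: "S > 0"
    and \<xi>: "\<And>i. i < R \<Longrightarrow> nontrivial_character config_topology (\<xi> i)"
    and sep: "\<And>i j. i < R \<Longrightarrow> j < R \<Longrightarrow> i \<noteq> j \<Longrightarrow> separated S (\<xi> i) (\<xi> j)"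
    and \<theta>: "\<theta> = (\<lambda>a. \<Prod>i<R. \<xi> i a)"
  obtains G where "G \<subseteq> active \<theta>" "card G = R"
    "\<And>k i. k \<in> G \<Longrightarrow> k < i \<Longrightarrow> real_of_int (i - k) < S \<Longrightarrow> i \<notin> active \<theta>"
proof -
  have c: "character config_topology (\<xi> i)" if "i < R" for i
    using \<xi>[OF that] by (simp add: nontrivial_character_def)
  define m where "m i = Max (active (\<xi> i))" for i
  have m: "m i \<in> active (\<xi> i)" "x \<in> active (\<xi> i) \<Longrightarrow> x \<le> m i" if "i < R" for i x
    using finite_active[OF c[OF that]] active_nonempty[OF \<xi>[OF that]] by (auto simp: m_def)
  have far: "S \<le> real_of_int \<bar>k - x\<bar>"
    if "i < R" "j < R" "i \<noteq> j" "k \<in> active (\<xi> i)" "x \<in> active (\<xi> j)" for i j k x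
    using sep[OF that(1-3)] that c by (simp add: separated_def char_support_eq_active)
  have disj: "k \<notin> active (\<xi> j)" if "i < R" "j < R" "i \<noteq> j" "k \<in> active (\<xi> i)" for i j k
    using far[OF that(1-4), of k] S by auto
  have sub: "active (\<xi> i) \<subseteq> active \<theta>" if "i < R" for i
  proof
    fix k assume k: "k \<in> active (\<xi> i)"
    then obtain x where x: "\<xi> i (spike k x) \<noteq> 1" by (auto simp: active_def)
    have "\<xi> j (spike k x) = 1" if "j \<in> {..<R} - {i}" for j
      using disj[of i j k] that k \<open>i < R\<close> by (auto simp: active_def)
    then have "\<theta> (spike k x) = \<xi> i (spike k x)"
      using that unfolding \<theta> by (simp add: prod.remove[of "{..<R}" i])
    with x have "\<theta> (spike k x) \<noteq> 1" by simp
    then show "k \<in> active \<theta>" unfolding active_def by blast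
  qed
  have sup: "\<exists>i<R. k \<in> active (\<xi> i)" if "k \<in> active \<theta>" for k
  proof (rule ccontr)
    assume "\<not> ?thesis"
    then have "\<theta> (spike k x) = 1" for x unfolding \<theta> by (intro prod.neutral) (auto simp: active_def)
    then show False using that by (auto simp: active_def)
  qed
  show thesis
  proof (rule that[of "m ` {..<R}"])
    show "m ` {..<R} \<subseteq> active \<theta>" using sub m(1) by blast
    have "inj_on m {..<R}"
      by (rule inj_onI) (metis disj lessThan_iff m(1))
    then show "card (m ` {..<R}) = R" by (simp add: card_image)
    fix k i assume "k \<in> m ` {..<R}" and i: "k < i" "real_of_int (i - k) < S"
    then obtain l where l: "l < R" "k = m l" by auto
    show "i \<notin> active \<theta>"
    proof
      assume "i \<in> active \<theta>"
      then obtain j where j: "j < R" "i \<in> active (\<xi> j)" using sup by blast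
      show False
      proof (cases "j = l")
        case True
        then show False using m(2)[OF j] l i by simp
      next
        case False
        then show False using far[OF l(1) j(1) _ m(1)[OF l(1)] j(2)] l i by simp
      qed
    qed
  qed
qed

text \<open>
  Separated factors have disjoint nonempty supports, so their number is at most the size of the
  support; hence the maximum defining the rank is attained.
\<close>

lemma char_rank_witness:
  fixes \<theta> :: "(int \<Rightarrow> 'p::prime_card mod_ring) \<Rightarrow> complex"
  assumes S: "S > 0" and \<theta>: "character config_topology \<theta>"
  obtains G where "G \<subseteq> active \<theta>" "card G = char_rank S \<theta>"
    "\<And>k i. k \<in> G \<Longrightarrow> k < i \<Longrightarrow> real_of_int (i - k) < S \<Longrightarrow> i \<notin> active \<theta>"
proof (cases "\<theta> = (\<lambda>_. 1)")
  case True
  then show ?thesis using that[of "{}"] by (simp add: char_rank_def)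
next
  case False
  define D where "D = {R :: nat. \<exists>\<xi>. (\<forall>i<R. nontrivial_character config_topology (\<xi> i)) \<and>
                       (\<forall>i<R. \<forall>j<R. i \<noteq> j \<longrightarrow> separated S (\<xi> i) (\<xi> j)) \<and>
                       \<theta> = (\<lambda>a. \<Prod>i<R. \<xi> i a)}"
  have wit: "\<exists>G. G \<subseteq> active \<theta> \<and> card G = R \<and>
      (\<forall>k\<in>G. \<forall>i. k < i \<longrightarrow> real_of_int (i - k) < S \<longrightarrow> i \<notin> active \<theta>)" if R: "R \<in> D" for R
  proof -
    obtain \<xi> where \<xi>: "\<forall>i<R. nontrivial_character config_topology (\<xi> i)"
      "\<forall>i<R. \<forall>j<R. i \<noteq> j \<longrightarrow> separated S (\<xi> i) (\<xi> j)" "\<theta> = (\<lambda>a. \<Prod>i<R. \<xi> i a)"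
      using R by (auto simp: D_def)
    show ?thesis
      by (rule separated_factors[OF S, of R \<xi> \<theta>]) (use \<xi> in \<open>blast+\<close>)
  qed
  have "1 \<in> D"
    unfolding D_def using \<theta> False by (auto intro!: exI[of _ "\<lambda>_. \<theta>"] simp: nontrivial_character_def)
  moreover have "D \<subseteq> {..card (active \<theta>)}"
  proof
    fix R assume "R \<in> D"
    then obtain G where "G \<subseteq> active \<theta>" "card G = R" using wit by blast
    then show "R \<in> {..card (active \<theta>)}" using card_mono[OF finite_active[OF \<theta>], of G] by simp
  qed
  then have "finite D" by (rule finite_subset) simp
  ultimately have "Max D \<in> D" by (intro Max_in) auto
  moreover have "char_rank S \<theta> = Max D" using False by (simp add: char_rank_def D_def)
  ultimately show ?thesis using wit[of "Max D"] that by metis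
qed

section \<open>Fourier coefficients of quasi-Markov measures\<close>

lemma config_prob_facts:
  assumes "config_prob M"
  shows "prob_space M" "sets M = sets config_space" "space M = UNIV" "cylinder k w \<in> sets M"
  using assms sets_eq_imp_space_eq[of M config_space] cylinder_sets[of k w]
  by (auto simp: config_prob_def)

definition word_prob :: "(int \<Rightarrow> 'b) measure \<Rightarrow> 'b list \<Rightarrow> real" where
  "word_prob \<nu> w = measure \<nu> (cylinder 0 w)"

lemma measure_cylinder:
  fixes \<nu> :: "(int \<Rightarrow> 'b::finite) measure"
  assumes \<nu>: "config_prob \<nu>" and inv: "shift_invariant \<nu>"
  shows "measure \<nu> (cylinder k w) = word_prob \<nu> w"
proof -
  have "(config_shift (- k) :: (int \<Rightarrow> 'b) \<Rightarrow> _) \<in> measurable config_space config_space"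
    by (rule measurable_continuous_config, rule continuous_mapI_window)
      (auto simp: config_shift_def intro!: exI[of _ "{_ + k}"])
  then have "config_shift (- k) \<in> measurable \<nu> \<nu>"
    using config_prob_facts[OF \<nu>] by (simp cong: measurable_cong_sets)
  then have "measure (distr \<nu> \<nu> (config_shift (- k))) (cylinder 0 w)
      = measure \<nu> (config_shift (- k) -` cylinder 0 w \<inter> space \<nu>)"
    using config_prob_facts[OF \<nu>] by (intro measure_distr) auto
  moreover have "config_shift (- k) -` cylinder 0 w \<inter> space \<nu> = cylinder k w"
    using config_prob_facts[OF \<nu>] by (auto simp: cylinder_def block_shift)
  ultimately show ?thesis using inv by (simp add: shift_invariant_def word_prob_def)
qed

lemma sum_measure_cylinder:
  fixes \<nu> :: "(int \<Rightarrow> 'b::finite) measure"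
  assumes \<nu>: "config_prob \<nu>"
  shows "(\<Sum>c\<in>UNIV. measure \<nu> (cylinder k (u @ [c] @ v)))
    = measure \<nu> (cylinder k u \<inter> cylinder (k + int (length u) + 1) v)"
proof -
  interpret prob_space \<nu> using config_prob_facts[OF \<nu>] by simp
  have "(\<Sum>c\<in>UNIV. measure \<nu> (cylinder k (u @ [c] @ v))) = measure \<nu> (\<Union>c. cylinder k (u @ [c] @ v))"
    using config_prob_facts[OF \<nu>]
    by (intro finite_measure_finite_Union[symmetric])
      (auto simp: disjoint_family_on_def cylinder_append, auto simp: cylinder_def)
  also have "(\<Union>c. cylinder k (u @ [c] @ v)) = cylinder k u \<inter> cylinder (k + int (length u) + 1) v"
  proof -
    have "(\<Union>c. cylinder (k + int (length u)) [c]) = UNIV" by (auto simp: mem_cylinder)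
    then show ?thesis by (simp only: cylinder_append list.size) auto
  qed
  finally show ?thesis .
qed

lemma cylinder_Nil [simp]: "cylinder k [] = UNIV"
  by (auto simp: cylinder_def block_def)

text \<open>
  A chain with memory \<open>N\<close> also has every longer memory: write \<open>w = w1 @ w2\<close> with \<open>w2\<close> of length
  \<open>N\<close> and apply the defining property to \<open>w2\<close> with the pasts \<open>u @ w1\<close> and \<open>w1\<close>.
\<close>

lemma markov_step:
  assumes m: "markov_measure N \<nu>" and inv: "shift_invariant (\<nu> :: (int \<Rightarrow> 'b::finite) measure)" and w: "length w \<ge> N"
  shows "word_prob \<nu> (u @ w @ [c]) * word_prob \<nu> w = word_prob \<nu> (u @ w) * word_prob \<nu> (w @ [c])"
proof -
  let ?p = "word_prob \<nu>"
  have \<nu>: "config_prob \<nu>" using m by (simp add: markov_measure_def)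
  interpret prob_space \<nu> using config_prob_facts[OF \<nu>] by simp
  note mc = measure_cylinder[OF \<nu> inv]
  have right: "?p (x @ y) \<le> ?p y" for x y
    unfolding mc[symmetric, where k = "int (length x)" and w = y] mc[symmetric, where k = 0 and w = "x @ y"]
    using config_prob_facts[OF \<nu>] by (intro finite_measure_mono) (auto simp: cylinder_append)
  have left: "?p (x @ y) \<le> ?p x" for x y
    unfolding word_prob_def
    using config_prob_facts[OF \<nu>] by (intro finite_measure_mono) (auto simp: cylinder_append)
  have nn: "0 \<le> ?p x" for x by (simp add: word_prob_def)
  define w1 where "w1 = take (length w - N) w"
  define w2 where "w2 = drop (length w - N) w"
  have w12: "w = w1 @ w2" "length w2 = N" using w by (auto simp: w1_def w2_def)
  have step: "?p (x @ w2 @ [c]) * ?p w2 = ?p (x @ w2) * ?p (w2 @ [c])" for x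
  proof (cases "?p (x @ w2) = 0")
    case True
    then show ?thesis using left[of "x @ w2" "[c]"] nn[of "x @ w2 @ [c]"] by simp
  next
    case False
    then have "?p w2 \<noteq> 0" using right[of x w2] nn[of "x @ w2"] by simp
    moreover have "?p (x @ w2 @ [c]) / ?p (x @ w2) = ?p (w2 @ [c]) / ?p w2"
      using m w12(2) False unfolding markov_measure_def mc by blast
    ultimately show ?thesis using False by (simp add: field_simps)
  qed
  show ?thesis
  proof (cases "?p w2 = 0")
    case True
    have "?p w = 0" "?p (u @ w) = 0" 
      using True right[of w1 w2] right[of "u @ w1" w2] nn[of w] nn[of "u @ w"] by (auto simp: w12(1))
    then show ?thesis by simp
  next
    case False
    have "(?p (u @ w @ [c]) * ?p w) * ?p w2 = (?p (u @ w) * ?p (w2 @ [c])) * ?p w"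
      using step[of "u @ w1"] by (simp add: w12(1) ac_simps)
    also have "\<dots> = (?p (u @ w) * ?p (w @ [c])) * ?p w2"
      using step[of w1] by (simp add: w12(1) ac_simps)
    finally show ?thesis using False by simp
  qed
qed

lemma word_chain_markov:
  assumes m: "markov_measure N \<nu>" and inv: "shift_invariant (\<nu> :: (int \<Rightarrow> 'b::finite) measure)" and n: "N \<le> n"
  shows "word_chain (word_prob \<nu>) n"
proof
  let ?p = "word_prob \<nu>"
  have \<nu>: "config_prob \<nu>" using m by (simp add: markov_measure_def)
  interpret prob_space \<nu> using config_prob_facts[OF \<nu>] by simp
  note mc = measure_cylinder[OF \<nu> inv]
  show nn: "0 \<le> ?p w" for w by (simp add: word_prob_def)
  show "?p [] = 1" using prob_space config_prob_facts[OF \<nu>] by (simp add: word_prob_def)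
  show "(\<Sum>c\<in>UNIV. ?p (w @ [c])) = ?p w" for w
    using sum_measure_cylinder[OF \<nu>, of 0 w "[]"] by (simp add: word_prob_def)
  show "(\<Sum>c\<in>UNIV. ?p (c # w)) = ?p w" for w
    using sum_measure_cylinder[OF \<nu>, of 0 "[]" w] by (simp add: mc)
  have left: "?p (x @ y) \<le> ?p x" for x y
    unfolding word_prob_def
    using config_prob_facts[OF \<nu>] by (intro finite_measure_mono) (auto simp: cylinder_append)
  show "?p (u @ w @ v) * ?p w = ?p (u @ w) * ?p (w @ v)" if w: "length w = n" for u w v
  proof (induction v rule: rev_induct)
    case (snoc c v)
    show ?case
    proof (cases "?p (w @ v) = 0")
      case True
      have "?p (w @ v @ [c]) = 0" using left[of "w @ v" "[c]"] nn[of "w @ v @ [c]"] True by simp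
      moreover have "?p (u @ w @ v @ [c]) * ?p w = 0"
        using left[of "u @ w @ v" "[c]"] nn[of "u @ w @ v @ [c]"] snoc True by auto
      ultimately show ?thesis by simp
    next
      case False
      have "?p (u @ w @ v @ [c]) * ?p (w @ v) = ?p (u @ w @ v) * ?p (w @ v @ [c])"
        using markov_step[OF m inv, of "w @ v" u c] w n by simp
      then have "(?p (u @ w @ v @ [c]) * ?p w) * ?p (w @ v) = (?p (u @ w @ v) * ?p w) * ?p (w @ v @ [c])"
        by (simp add: ac_simps)
      also have "\<dots> = (?p (u @ w) * ?p (w @ v @ [c])) * ?p (w @ v)"
        unfolding snoc by (simp add: ac_simps)
      finally show ?thesis using False by simp
    qed
  qed simp
qed

text \<open>
  Mixing makes the joint probability of \<open>x\<close> and a distant \<open>y\<close> converge to the product of their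
  positive probabilities, so some word in between has positive probability; there are finitely many
  pairs of words of length \<open>n\<close>.
\<close>

lemma mixing_connects:
  assumes \<nu>: "config_prob (\<nu> :: (int \<Rightarrow> 'b::finite) measure)" and mix: "shift_mixing \<nu>"
  obtains M where "\<And>x y m. length x = n \<Longrightarrow> length y = n \<Longrightarrow> 0 < word_prob \<nu> x \<Longrightarrow> 0 < word_prob \<nu> y \<Longrightarrow> M \<le> m
      \<Longrightarrow> \<exists>s\<in>words m. 0 < word_prob \<nu> (x @ s @ y)"
proof -
  let ?p = "word_prob \<nu>"
  have inv: "shift_invariant \<nu>" using mix by (simp add: shift_mixing_def)
  interpret prob_space \<nu> using config_prob_facts[OF \<nu>] by simp
  note mc = measure_cylinder[OF \<nu> inv]
  have conn: "\<forall>\<^sub>F m in sequentially. \<exists>s\<in>words m. 0 < ?p (x @ s @ y)" if "0 < ?p x" "0 < ?p y" for x y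
  proof -
    have "(\<lambda>m. measure \<nu> (config_shift (int m) -` cylinder 0 x \<inter> cylinder 0 y)) \<longlonglongrightarrow> ?p x * ?p y"
      using mix config_prob_facts[OF \<nu>] unfolding shift_mixing_def word_prob_def by blast
    then have "\<forall>\<^sub>F m in sequentially. 0 < measure \<nu> (config_shift (int m) -` cylinder 0 x \<inter> cylinder 0 y)"
      by (rule order_tendstoD(1)) (use that in simp)
    then have "\<forall>\<^sub>F m in sequentially. 0 < measure \<nu> (config_shift (int (m + length x)) -` cylinder 0 x \<inter> cylinder 0 y)"
      by (rule eventually_sequentially_seg[THEN iffD2])
    then show ?thesis
    proof eventually_elim
      case (elim m)
      let ?k = "- int (m + length x)"
      have "config_shift (int (m + length x)) -` cylinder 0 x \<inter> cylinder 0 y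
          \<subseteq> (\<Union>s\<in>words m. cylinder ?k (x @ s @ y))"
      proof
        fix b assume b: "b \<in> config_shift (int (m + length x)) -` cylinder 0 x \<inter> cylinder 0 y"
        have "b \<in> cylinder ?k (x @ block b (?k + int (length x)) m @ y)"
          using b by (auto simp: cylinder_append) (auto simp: cylinder_def block_shift)
        then show "b \<in> (\<Union>s\<in>words m. cylinder ?k (x @ s @ y))"
          by (intro UN_I[of "block b (?k + int (length x)) m"]) (auto simp: words_def)
      qed
      then have "measure \<nu> (config_shift (int (m + length x)) -` cylinder 0 x \<inter> cylinder 0 y)
          \<le> measure \<nu> (\<Union>s\<in>words m. cylinder ?k (x @ s @ y))"
        using config_prob_facts[OF \<nu>] by (intro finite_measure_mono sets.finite_UN) auto
      also have "\<dots> \<le> (\<Sum>s\<in>words m. measure \<nu> (cylinder ?k (x @ s @ y)))"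
        using config_prob_facts[OF \<nu>] by (intro finite_measure_subadditive_finite) auto
      finally have "0 < (\<Sum>s\<in>words m. ?p (x @ s @ y))" using elim by (simp add: mc)
      then show ?case by (metis not_less sum_nonpos)
    qed
  qed
  define A where "A = {x \<in> words n. 0 < ?p x}"
  have "finite (A \<times> A)" by (simp add: A_def)
  then have "\<forall>\<^sub>F m in sequentially. \<forall>(x, y)\<in>A \<times> A. \<exists>s\<in>words m. 0 < ?p (x @ s @ y)"
    by (intro eventually_ball_finite) (auto simp: A_def conn)
  then obtain M where "\<And>m x y. M \<le> m \<Longrightarrow> x \<in> A \<Longrightarrow> y \<in> A \<Longrightarrow> \<exists>s\<in>words m. 0 < ?p (x @ s @ y)"
    unfolding eventually_sequentially by fast
  then show thesis using that[of M] by (simp add: A_def words_def)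
qed

lemma take_drop_block:
  "i + n \<le> l \<Longrightarrow> take n (drop i (block b k l)) = block b (k + int i) n"
  by (rule nth_equalityI) (auto simp: algebra_simps)

lemma config_point_measurable: "{a :: int \<Rightarrow> 'a::finite} \<in> sets config_space"
proof -
  have "{a} = {b \<in> space config_space. \<forall>k. b k = a k}" by auto
  also have "\<dots> \<in> sets config_space"
  proof (rule sets.sets_Collect_countable_All)
    fix k
    have "(\<lambda>b. b k) -` {a k} \<inter> space config_space \<in> sets config_space"
      by (rule measurable_sets[OF measurable_coordinate]) simp
    then show "{b \<in> space config_space. b k = a k} \<in> sets config_space"
      by (simp add: vimage_def Int_def conj_commute)
  qed
  finally show ?thesis .
qed

text \<open>
  If the code took one value \<open>c\<close> on all words of positive probability, almost every image
  configuration would be constantly \<open>c\<close>.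
\<close>

lemma nonconstant_code:
  fixes \<nu> :: "(int \<Rightarrow> 'b::finite) measure" and \<Psi> :: "(int \<Rightarrow> 'b) \<Rightarrow> (int \<Rightarrow> 'a::finite)"
  assumes \<nu>: "config_prob \<nu>" and inv: "shift_invariant \<nu>"
    and meas: "\<Psi> \<in> measurable config_space config_space"
    and code: "\<And>b k. \<Psi> b k = \<psi> (block b (k - int r) n)"
    and npm: "\<And>a. measure (distr \<nu> config_space \<Psi>) {a} \<noteq> 1"
  shows "\<exists>x y. length x = n \<and> length y = n \<and> 0 < word_prob \<nu> x \<and> 0 < word_prob \<nu> y \<and> \<psi> x \<noteq> \<psi> y"
proof (rule ccontr)
  assume neg: "\<not> ?thesis"
  let ?p = "word_prob \<nu>"
  interpret prob_space \<nu> using config_prob_facts[OF \<nu>] by simp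
  note mc = measure_cylinder[OF \<nu> inv]
  define c where "c = \<psi> (SOME x. length x = n \<and> 0 < ?p x)"
  have const: "\<psi> x = c" if "length x = n" "0 < ?p x" for x
    using someI[of "\<lambda>x. length x = n \<and> 0 < ?p x" x] that neg unfolding c_def by blast
  have "AE b in \<nu>. \<Psi> b k = c" for k
  proof -
    have "AE b in \<nu>. \<forall>w\<in>{w \<in> words n. ?p w = 0}. b \<notin> cylinder (k - int r) w"
    proof (rule AE_finite_allI)
      fix w assume "w \<in> {w \<in> words n. ?p w = 0}"
      then have "cylinder (k - int r) w \<in> null_sets \<nu>"
        using config_prob_facts[OF \<nu>] by (auto simp: null_sets_def emeasure_eq_measure mc)
      then show "AE b in \<nu>. b \<notin> cylinder (k - int r) w" by (rule AE_not_in)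
    qed simp
    then show ?thesis
    proof eventually_elim
      case (elim b)
      let ?w = "block b (k - int r) n"
      have "b \<in> cylinder (k - int r) ?w" by (simp add: cylinder_def)
      then have "?p ?w \<noteq> 0" using elim by (force simp: words_def)
      then have "0 < ?p ?w" by (simp add: word_prob_def zero_less_measure_iff)
      then show ?case unfolding code by (intro const) auto
    qed
  qed
  then have "AE b in \<nu>. \<forall>k. \<Psi> b k = c" by (simp add: AE_all_countable)
  then have "AE b in \<nu>. b \<in> \<Psi> -` {\<lambda>_. c} \<inter> space \<nu>"
    by eventually_elim (auto simp: config_prob_facts(3)[OF \<nu>])
  moreover have meas': "\<Psi> \<in> measurable \<nu> config_space"
    using meas config_prob_facts[OF \<nu>] by (simp cong: measurable_cong_sets)
  ultimately have "prob (\<Psi> -` {\<lambda>_. c} \<inter> space \<nu>) = 1"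
    using prob_eq_1[OF measurable_sets[OF meas' config_point_measurable]] by blast
  then show False using npm[of "\<lambda>_. c"] measure_distr[OF meas' config_point_measurable] by simp
qed

lemma quasi_markov_config_prob:
  assumes "quasi_markov TYPE('b::finite) (\<mu> :: (int \<Rightarrow> 'a) measure)"
  shows "config_prob \<mu>"
proof -
  obtain \<nu> :: "(int \<Rightarrow> 'b) measure" and N \<Psi> where
    "markov_measure N \<nu>" and "block_map \<Psi>" and \<mu>: "\<mu> = distr \<nu> config_space \<Psi>"
    using assms unfolding quasi_markov_def by blast
  then have \<nu>: "config_prob \<nu>" and "\<Psi> \<in> measurable config_space config_space"
    by (auto simp: markov_measure_def block_map_def intro: measurable_continuous_config)
  then have "\<Psi> \<in> measurable \<nu> config_space"
    using config_prob_facts[OF \<nu>] by (simp cong: measurable_cong_sets)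
  then show ?thesis
    unfolding config_prob_def \<mu> using prob_space.prob_space_distr[OF config_prob_facts(1)[OF \<nu>]] by simp
qed

text \<open>
  The scale \<open>S\<close> is the length of a window, so that the coordinates supplied by
  \<open>char_rank_witness\<close> are followed by gaps long enough for \<open>character_sum_decay\<close>.
\<close>

theorem quasi_markov_character_decay:
  fixes \<mu> :: "(int \<Rightarrow> 'p::prime_card mod_ring) measure"
  assumes qm: "quasi_markov TYPE('b::finite) \<mu>" and npm: "\<And>a. measure \<mu> {a} \<noteq> 1"
  obtains S \<rho> :: real where "0 < S" "0 \<le> \<rho>" "\<rho> < 1"
    "\<And>\<theta>. character config_topology \<theta> \<Longrightarrow> norm (\<integral>a. \<theta> a \<partial>\<mu>) \<le> \<rho> ^ char_rank S \<theta>"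
proof -
  obtain \<nu> :: "(int \<Rightarrow> 'b) measure" and N \<Psi> where
    markov: "markov_measure N \<nu>" and mix: "shift_mixing \<nu>" and bm: "block_map \<Psi>"
    and \<mu>: "\<mu> = distr \<nu> config_space \<Psi>"
    using qm unfolding quasi_markov_def by blast
  have \<nu>: "config_prob \<nu>" using markov by (simp add: markov_measure_def)
  have inv: "shift_invariant \<nu>" using mix by (simp add: shift_mixing_def)
  note mc = measure_cylinder[OF \<nu> inv]
  have cont: "continuous_map config_topology config_topology \<Psi>"
    and comm: "\<And>v b. \<Psi> (config_shift v b) = config_shift v (\<Psi> b)"
    using bm by (auto simp: block_map_def)
  have meas: "\<Psi> \<in> measurable config_space config_space" by (rule measurable_continuous_config[OF cont])
  have meas': "\<Psi> \<in> measurable \<nu> config_space"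
    using meas config_prob_facts[OF \<nu>] by (simp cong: measurable_cong_sets)
  obtain r0 :: nat where r0: "\<And>b b'. (\<And>i. \<bar>i\<bar> \<le> int r0 \<Longrightarrow> b i = b' i) \<Longrightarrow> \<Psi> b 0 = \<Psi> b' 0"
    using coordinate_window[OF cont, of 0] by blast
  \<comment> \<open>A window that covers both the range of the block map and the memory of the chain.\<close>
  define r where "r = max r0 N"
  define n where "n = 2 * r + 1"
  define \<psi> where "\<psi> w = \<Psi> (unblock (- int r) w) 0" for w
  have code0: "\<Psi> b 0 = \<psi> (block b (- int r) n)" for b
    unfolding \<psi>_def n_def by (rule factor_block, rule r0) (auto simp: r_def)
  have code: "\<Psi> b k = \<psi> (block b (k - int r) n)" for b k
  proof -
    have "\<Psi> b k = \<Psi> (config_shift (- k) b) 0" unfolding comm by (simp add: config_shift_def)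
    then show ?thesis by (simp add: code0 block_shift)
  qed
  obtain M where M: "\<And>x y m. length x = n \<Longrightarrow> length y = n \<Longrightarrow> 0 < word_prob \<nu> x \<Longrightarrow> 0 < word_prob \<nu> y \<Longrightarrow> M \<le> m
      \<Longrightarrow> \<exists>s\<in>words m. 0 < word_prob \<nu> (x @ s @ y)"
    using mixing_connects[OF \<nu> mix, of n] by blast
  have "N \<le> n" by (simp add: n_def r_def)
  then interpret wc: word_chain "word_prob \<nu>" n
    by (rule word_chain_markov[OF markov inv])
  interpret coded_word_chain "word_prob \<nu>" n M \<psi>
  proof
    show "\<exists>x y. length x = n \<and> length y = n \<and> 0 < word_prob \<nu> x \<and> 0 < word_prob \<nu> y \<and> \<psi> x \<noteq> \<psi> y"
      using \<nu> inv meas code npm unfolding \<mu> by (rule nonconstant_code)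
  qed (rule M)
  obtain \<rho> where \<rho>: "0 \<le> \<rho>" "\<rho> < 1" and decay:
    "\<And>e G a T. (\<And>k x. e k x ^ CARD('p) = 1) \<Longrightarrow> finite G \<Longrightarrow> (\<And>k. k \<in> G \<Longrightarrow> inj (e k)) \<Longrightarrow>
       (\<And>k i. k \<in> G \<Longrightarrow> k < i \<Longrightarrow> i < k + int window_length \<Longrightarrow> e i = (\<lambda>_. 1)) \<Longrightarrow>
       (\<And>k. k \<in> G \<Longrightarrow> a + int window_offset \<le> k \<and> k + int (n + M) \<le> a + int T) \<Longrightarrow>
       norm (\<Sum>w\<in>words (T + n). word_prob \<nu> w * phase e a w) \<le> \<rho> ^ card G"
    by (rule character_sum_decay[of "CARD('p)"]) auto
  have S: "0 < real window_length" unfolding window_length_def by (simp add: n_def)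
  show thesis
  proof (rule that[OF S \<rho>])
    fix \<theta> :: "(int \<Rightarrow> 'p mod_ring) \<Rightarrow> complex" assume \<theta>: "character config_topology \<theta>"
    obtain G where G: "G \<subseteq> active \<theta>" "card G = char_rank (real window_length) \<theta>"
      "\<And>k i. k \<in> G \<Longrightarrow> k < i \<Longrightarrow> real_of_int (i - k) < real window_length \<Longrightarrow> i \<notin> active \<theta>"
      by (rule char_rank_witness[OF S \<theta>]) blast
    define e where "e k x = \<theta> (spike k x)" for k x
    have e: "character (discrete_topology UNIV) (e k)" for k
      using character_coordinate[OF \<theta>, of k] by (simp add: e_def[abs_def])
    define L where "L = Max (insert 0 (abs ` active \<theta>))"
    have L: "\<bar>k\<bar> \<le> L" if "k \<in> active \<theta>" for k
      using that finite_active[OF \<theta>] by (simp add: L_def)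
    have "0 \<le> L" using finite_active[OF \<theta>] by (simp add: L_def)
    \<comment> \<open>The coordinates \<open>a, \<dots>, a + T - 1\<close> contain the support and a full window around each
      of its elements.\<close>
    define a where "a = - L - int window_offset"
    define T where "T = nat (2 * L) + window_offset + n + M"
    have aT: "a + int T = L + int (n + M)" using \<open>0 \<le> L\<close> by (simp add: a_def T_def)
    have "\<theta> (\<Psi> b) = phase e a (block b (a - int r) (T + n))" for b
    proof -
      have "active \<theta> \<subseteq> {a..<a + int T}"
      proof
        fix k assume "k \<in> active \<theta>"
        from L[OF this] show "k \<in> {a..<a + int T}" unfolding aT by (auto simp: a_def n_def)
      qed
      then have "\<theta> (\<Psi> b) = (\<Prod>k\<in>{a..<a + int T}. e k (\<Psi> b k))"
        unfolding e_def by (intro character_eq_prod[OF \<theta>]) auto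
      also have "\<dots> = (\<Prod>i<T. e (a + int i) (\<Psi> b (a + int i)))"
        by (rule prod.reindex_bij_witness[where i = "\<lambda>i. a + int i" and j = "\<lambda>k. nat (k - a)"]) auto
      also have "\<dots> = phase e a (block b (a - int r) (T + n))"
        unfolding phase_def by (intro prod.cong) (auto simp: take_drop_block code algebra_simps)
      finally show ?thesis .
    qed
    moreover have "\<theta> \<in> borel_measurable config_space"
      using \<theta> by (intro borel_measurable_continuous_config) (simp add: character_def)
    ultimately have "(\<integral>a. \<theta> a \<partial>\<mu>) = (\<integral>b. phase e a (block b (a - int r) (T + n)) \<partial>\<nu>)"
      unfolding \<mu> by (subst integral_distr[OF meas']) auto
    also have "\<dots> = (\<Sum>w\<in>words (T + n). word_prob \<nu> w * phase e a w)"
      by (subst integral_block[OF \<nu>]) (simp add: mc scaleR_conv_of_real)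
    also have "norm \<dots> \<le> \<rho> ^ card G"
    proof (rule decay)
      show "e k x ^ CARD('p) = 1" for k x using alphabet_character_root[OF e] .
      show "finite G" using G(1) finite_active[OF \<theta>] by (rule finite_subset)
      show "inj (e k)" if "k \<in> G" for k
        using e[of k] that G(1)
        by (intro alphabet_character_inj[of "discrete_topology UNIV"])
          (auto simp: nontrivial_character_def active_def e_def fun_eq_iff)
      show "e i = (\<lambda>_. 1)" if "k \<in> G" "k < i" "i < k + int window_length" for k i
      proof -
        have "i \<notin> active \<theta>" using that by (intro G(3)[of k]) auto
        then show ?thesis by (auto simp: active_def e_def)
      qed
      show "a + int window_offset \<le> k \<and> k + int (n + M) \<le> a + int T" if "k \<in> G" for k
        using L[of k] that G(1) unfolding aT by (auto simp: a_def)
    qed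
    finally show "norm (\<integral>a. \<theta> a \<partial>\<mu>) \<le> \<rho> ^ char_rank (real window_length) \<theta>" by (simp add: G(2))
  qed
qed

section \<open>Fourier modes and cylinders\<close>

definition basic_character :: "'p::prime_card mod_ring \<Rightarrow> complex" where
  "basic_character x =
     exp (2 * of_real pi * \<i> * of_nat (nat (to_int_mod_ring x)) / of_nat CARD('p))"

lemma basic_character_add:
  "basic_character (x + y) = basic_character x * basic_character (y :: 'p::prime_card mod_ring)"
proof -
  have nn: "0 \<le> to_int_mod_ring z" for z :: "'p mod_ring"
    using range_to_int_mod_ring[where 'a = 'p] by (auto simp: set_eq_iff)
  have "to_int_mod_ring (x + y) = (to_int_mod_ring x + to_int_mod_ring y) mod int CARD('p)"
    by transfer simp
  then have "nat (to_int_mod_ring (x + y)) = (nat (to_int_mod_ring x) + nat (to_int_mod_ring y)) mod CARD('p)"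
    using nn by (simp add: nat_mod_distrib nat_add_distrib)
  then have "basic_character (x + y) = exp (2 * of_real pi * \<i> * of_nat (nat (to_int_mod_ring x) + nat (to_int_mod_ring y)) / of_nat CARD('p))"
    unfolding basic_character_def
    by (subst complex_root_unity_eq) (auto simp: Suc_le_eq)
  then show ?thesis
    by (simp add: basic_character_def exp_add[symmetric] algebra_simps add_divide_distrib)
qed

lemma norm_basic_character: "norm (basic_character x) = 1"
  by (simp add: basic_character_def)

lemma basic_character_eq_1: "basic_character x = 1 \<longleftrightarrow> x = (0 :: 'p::prime_card mod_ring)"
proof -
  have r: "to_int_mod_ring x \<in> {0..<int CARD('p)}"
    using range_to_int_mod_ring[where 'a = 'p] by blast
  have "basic_character x = 1 \<longleftrightarrow> CARD('p) dvd nat (to_int_mod_ring x)"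
    unfolding basic_character_def by (rule complex_root_unity_eq_1) (auto simp: Suc_le_eq)
  also have "\<dots> \<longleftrightarrow> nat (to_int_mod_ring x) = 0"
  proof -
    have "nat (to_int_mod_ring x) < CARD('p)" using r by auto
    then show ?thesis by (metis dvd_0_right nat_dvd_not_less neq0_conv)
  qed
  also have "\<dots> \<longleftrightarrow> to_int_mod_ring x = 0"
  proof -
    have "nat t = 0 \<longleftrightarrow> t = 0" if "0 \<le> t" for t :: int using that by auto
    then show ?thesis using r by (simp only: atLeastLessThan_iff)
  qed
  finally show ?thesis by (simp add: to_int_mod_ring_hom.hom_0_iff)
qed

lemma sum_basic_character:
  "(\<Sum>z\<in>UNIV. basic_character (z * x)) = (if x = 0 then of_nat CARD('p) else 0)"
  for x :: "'p::prime_card mod_ring"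
proof (cases "x = 0")
  case True
  then show ?thesis using basic_character_eq_1[of "0 :: 'p mod_ring"] by simp
next
  case False
  let ?S = "\<Sum>z\<in>UNIV. basic_character (z * x)"
  have "?S = (\<Sum>z\<in>UNIV. basic_character ((z + 1) * x))"
    by (rule sum.reindex_bij_witness[where i = "\<lambda>z. z + 1" and j = "\<lambda>z. z - 1"]) auto
  also have "\<dots> = ?S * basic_character x"
    by (simp add: distrib_right basic_character_add sum_distrib_right)
  finally have "?S * (basic_character x - 1) = 0" by (simp add: algebra_simps)
  then show ?thesis using False basic_character_eq_1[of x] by simp
qed

definition fourier_mode :: "int \<Rightarrow> 'p::prime_card mod_ring list \<Rightarrow> (int \<Rightarrow> 'p mod_ring) \<Rightarrow> complex" where
  "fourier_mode k u a = (\<Prod>i<length u. basic_character (u ! i * a (k + int i)))"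

lemma character_fourier_mode: "character config_topology (fourier_mode k u)"
  unfolding character_def
proof (intro conjI allI)
  show "continuous_map config_topology euclidean (fourier_mode k u)"
    by (rule continuous_windowI[of "(\<lambda>i. k + int i) ` {..<length u}"])
      (auto simp: fourier_mode_def intro!: prod.cong)
  show "norm (fourier_mode k u x) = 1" for x
    by (simp add: fourier_mode_def norm_basic_character flip: prod_norm)
  show "fourier_mode k u (x + y) = fourier_mode k u x * fourier_mode k u y" for x y
    by (simp add: fourier_mode_def distrib_left basic_character_add prod.distrib)
qed

lemma nontrivial_fourier_mode:
  assumes "i < length u" "u ! i \<noteq> 0"
  shows "nontrivial_character config_topology (fourier_mode k u)"
proof -
  have "fourier_mode k u (spike (k + int i) 1) = (\<Prod>j<length u. if j = i then basic_character (u ! i) else 1)"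
    unfolding fourier_mode_def
    using basic_character_eq_1[of "0 :: 'a mod_ring"] by (intro prod.cong) (auto simp: spike_def)
  also have "\<dots> \<noteq> 1" using assms by (simp add: basic_character_eq_1)
  finally show ?thesis using character_fourier_mode by (auto simp: nontrivial_character_def)
qed

lemma fourier_mode_trivial:
  assumes "\<forall>i<length u. u ! i = 0"
  shows "fourier_mode k u = (\<lambda>_. 1)"
  using assms basic_character_eq_1[of "0 :: 'a mod_ring"] by (auto simp: fourier_mode_def fun_eq_iff)

lemma sum_words_prod:
  fixes f :: "nat \<Rightarrow> 'b::finite \<Rightarrow> 'c::comm_semiring_1"
  shows "(\<Sum>u\<in>words m. \<Prod>i<m. f i (u ! i)) = (\<Prod>i<m. \<Sum>c\<in>UNIV. f i c)"
proof (induction m arbitrary: f)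
  case (Suc m)
  show ?case
    using Suc.IH[of "\<lambda>i. f (Suc i)"]
    by (simp add: sum_words_Suc_left prod.lessThan_Suc_shift sum_distrib_right del: prod.lessThan_Suc
      flip: sum_distrib_left)
qed simp

text \<open>
  Orthogonality: \<open>\<Sum>\<^sub>z basic_character (z * x)\<close> detects \<open>x = 0\<close>, and the product over the
  positions of \<open>w\<close> expands into a sum over modes.
\<close>

lemma cylinder_fourier:
  fixes w :: "'p::prime_card mod_ring list"
  shows "of_nat (CARD('p) ^ length w) * indicator (cylinder k w) a
    = (\<Sum>u\<in>words (length w). (\<Prod>i<length w. basic_character (- (u ! i * w ! i))) * fourier_mode k u a)"
proof -
  have "(\<Sum>u\<in>words (length w). (\<Prod>i<length w. basic_character (- (u ! i * w ! i))) * fourier_mode k u a)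
      = (\<Sum>u\<in>words (length w). \<Prod>i<length w. basic_character (u ! i * (a (k + int i) - w ! i)))"
    by (intro sum.cong refl)
      (auto simp: words_def fourier_mode_def prod.distrib[symmetric] basic_character_add[symmetric] algebra_simps)
  also have "\<dots> = (\<Prod>i<length w. if a (k + int i) = w ! i then of_nat CARD('p) else 0)"
    by (simp add: sum_words_prod[where f = "\<lambda>i c. basic_character (c * (a (k + int i) - w ! i))"] sum_basic_character)
  also have "\<dots> = of_nat (CARD('p) ^ length w) * indicator (cylinder k w) a"
  proof (cases "a \<in> cylinder k w")
    case True
    then show ?thesis by (simp add: mem_cylinder)
  next
    case False
    then obtain i where "i < length w" "a (k + int i) \<noteq> w ! i" by (auto simp: mem_cylinder)
    then have "(\<Prod>i<length w. if a (k + int i) = w ! i then of_nat CARD('p) else 0) = (0::complex)"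
      by (intro prod_zero) auto
    then show ?thesis using False by simp
  qed
  finally show ?thesis by simp
qed

lemma config_prob_integrable:
  fixes h :: "(int \<Rightarrow> 'b::finite) \<Rightarrow> 'c::{banach, second_countable_topology}"
  assumes M: "config_prob M" and h: "continuous_map config_topology euclidean h"
  shows "integrable M h"
proof -
  interpret prob_space M using config_prob_facts[OF M] by simp
  obtain r :: nat where r: "\<And>b b'. (\<And>i. \<bar>i\<bar> \<le> int r \<Longrightarrow> b i = b' i) \<Longrightarrow> dist (h b) (h b') < 1"
    using continuous_window[OF h, of 1] by auto
  define g where "g w = h (unblock (- int r) w)" for w
  define B where "B = (\<Sum>w\<in>words (2 * r + 1). norm (g w)) + 1"
  have "norm (h b) \<le> B" for b
  proof -
    let ?w = "block b (- int r) (2 * r + 1)"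
    have "dist (h b) (g ?w) < 1" unfolding g_def by (rule r) (auto simp: unblock_def)
    moreover have "norm (g ?w) \<le> (\<Sum>w\<in>words (2 * r + 1). norm (g w))"
      by (rule member_le_sum) (auto simp: words_def[of "2 * r + 1"] words_def[of "Suc (2 * r)"] finite_words[unfolded words_def])
    ultimately show ?thesis
      using norm_triangle_ineq2[of "h b" "g ?w"] by (simp add: B_def dist_norm)
  qed
  moreover have "h \<in> borel_measurable M"
    using borel_measurable_continuous_config[OF h] config_prob_facts[OF M] by (simp cong: measurable_cong_sets)
  ultimately show ?thesis by (intro integrable_const_bound[where B = B]) auto
qed

lemma measure_cylinder_fourier:
  fixes w :: "'p::prime_card mod_ring list"
  assumes M: "config_prob M"
  shows "of_nat (CARD('p) ^ length w) * complex_of_real (measure M (cylinder k w))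
    = (\<Sum>u\<in>words (length w). (\<Prod>i<length w. basic_character (- (u ! i * w ! i))) * (\<integral>a. fourier_mode k u a \<partial>M))"
proof -
  interpret prob_space M using config_prob_facts[OF M] by simp
  have int: "integrable M (fourier_mode k u)" for u
    using character_fourier_mode[of k u] by (intro config_prob_integrable[OF M]) (simp add: character_def)
  have "of_nat (CARD('p) ^ length w) * complex_of_real (measure M (cylinder k w))
      = (\<integral>a. of_nat (CARD('p) ^ length w) * complex_of_real (indicator (cylinder k w) a) \<partial>M)"
    using config_prob_facts[OF M] by (simp add: integral_complex_of_real)
  also have "\<dots> = (\<integral>a. (\<Sum>u\<in>words (length w). (\<Prod>i<length w. basic_character (- (u ! i * w ! i))) * fourier_mode k u a) \<partial>M)"
    unfolding cylinder_fourier[symmetric] by (simp add: indicator_def of_bool_def if_distrib cong: if_cong)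
  also have "\<dots> = (\<Sum>u\<in>words (length w). (\<Prod>i<length w. basic_character (- (u ! i * w ! i))) * (\<integral>a. fourier_mode k u a \<partial>M))"
    using int by (subst Bochner_Integration.integral_sum) auto
  finally show ?thesis .
qed

section \<open>Weak-star convergence to the uniform measure\<close>

lemma uniform_bernoulli_config_prob: "config_prob (uniform_bernoulli :: (int \<Rightarrow> 'a::finite) measure)"
proof -
  interpret u: prob_space "uniform_count_measure (UNIV :: 'a set)"
    by (rule prob_space_uniform_count_measure) auto
  interpret product_prob_space "\<lambda>_ :: int. uniform_count_measure (UNIV :: 'a set)" UNIV
    by unfold_locales
  show ?thesis
    unfolding config_prob_def uniform_bernoulli_def config_space_def
    using P.prob_space_axioms
    by (auto intro!: sets_PiM_cong simp: sets_uniform_count_measure)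
qed

lemma uniform_bernoulli_cylinder:
  fixes w :: "'a::finite list"
  shows "measure uniform_bernoulli (cylinder k w) = 1 / CARD('a) ^ length w"
proof -
  interpret u: prob_space "uniform_count_measure (UNIV :: 'a set)"
    by (rule prob_space_uniform_count_measure) auto
  interpret product_prob_space "\<lambda>_ :: int. uniform_count_measure (UNIV :: 'a set)" UNIV
    by unfold_locales
  let ?J = "(\<lambda>i. k + int i) ` {..<length w}"
  let ?X = "\<lambda>j. {w ! nat (j - k)}"
  have "cylinder k w = prod_emb UNIV (\<lambda>_. uniform_count_measure (UNIV :: 'a set)) ?J (Pi\<^sub>E ?J ?X)"
    by (auto simp: prod_emb_def mem_cylinder space_PiM space_uniform_count_measure PiE_iff restrict_def)
  then have "emeasure uniform_bernoulli (cylinder k w) = (\<Prod>j\<in>?J. emeasure (uniform_count_measure (UNIV :: 'a set)) (?X j))"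
    unfolding uniform_bernoulli_def by (simp add: emeasure_PiM_emb sets_uniform_count_measure)
  also have "\<dots> = (\<Prod>i<length w. ennreal (1 / CARD('a)))"
    by (subst prod.reindex) (auto simp: inj_on_def emeasure_uniform_count_measure)
  also have "\<dots> = ennreal ((1 / CARD('a)) ^ length w)"
    by (simp add: ennreal_power)
  finally show ?thesis
    by (simp add: measure_def power_one_over)
qed

text \<open>
  Continuous functions are uniformly close to functions of a block, whose integrals are finite
  combinations of probabilities of cylinders.
\<close>

lemma weak_star_tendstoI:
  fixes M :: "'i \<Rightarrow> (int \<Rightarrow> 'a::finite) measure"
  assumes M: "\<And>j. config_prob (M j)" and L: "config_prob L"
    and cyl: "\<And>k w. ((\<lambda>j. measure (M j) (cylinder k w)) \<longlongrightarrow> measure L (cylinder k w)) G"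
  shows "weak_star_tendsto M L G"
  unfolding weak_star_tendsto_def
proof (intro allI impI)
  fix h :: "(int \<Rightarrow> 'a) \<Rightarrow> real"
  assume h: "continuous_map config_topology euclidean h"
  show "((\<lambda>j. \<integral>a. h a \<partial>M j) \<longlongrightarrow> (\<integral>a. h a \<partial>L)) G"
  proof (rule tendstoI)
    fix \<epsilon> :: real assume \<epsilon>: "0 < \<epsilon>"
    obtain r :: nat where r: "\<And>b b'. (\<And>i. \<bar>i\<bar> \<le> int r \<Longrightarrow> b i = b' i) \<Longrightarrow> dist (h b) (h b') < \<epsilon> / 3"
      using continuous_window[OF h, of "\<epsilon> / 3"] \<epsilon> by auto
    define g where "g a = h (unblock (- int r) (block a (- int r) (2 * r + 1)))" for a
    have hg: "\<bar>h a - g a\<bar> < \<epsilon> / 3" for a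
      unfolding g_def dist_real_def[symmetric] by (rule r) (auto simp: unblock_def)
    have g_cont: "continuous_map config_topology euclidean g"
      by (rule continuous_windowI[of "{- int r..int r}"])
        (auto simp: g_def block_def intro!: arg_cong[of _ _ h] arg_cong[of _ _ "unblock _"])
    have close: "\<bar>(\<integral>a. h a \<partial>N) - (\<integral>a. g a \<partial>N)\<bar> \<le> \<epsilon> / 3" if N: "config_prob N" for N
    proof -
      interpret prob_space N using config_prob_facts[OF N] by simp
      have int: "integrable N h" "integrable N g"
        using config_prob_integrable[OF N] h g_cont by auto
      then have "\<bar>(\<integral>a. h a \<partial>N) - (\<integral>a. g a \<partial>N)\<bar> = \<bar>\<integral>a. h a - g a \<partial>N\<bar>" by simp
      also have "\<dots> \<le> (\<integral>a. \<bar>h a - g a\<bar> \<partial>N)" by (rule integral_abs_bound)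
      also have "\<dots> \<le> (\<integral>a. \<epsilon> / 3 \<partial>N)"
        using int hg by (intro integral_mono) (auto intro: less_imp_le)
      finally show ?thesis by (simp add: prob_space)
    qed
    have g_int: "(\<integral>a. g a \<partial>N) = (\<Sum>w\<in>words (2 * r + 1). measure N (cylinder (- int r) w) *\<^sub>R h (unblock (- int r) w))"
      if "config_prob N" for N
      unfolding g_def by (rule integral_block[OF that])
    have "((\<lambda>j. \<integral>a. g a \<partial>M j) \<longlongrightarrow> (\<integral>a. g a \<partial>L)) G"
      unfolding g_int[OF M] g_int[OF L] by (intro tendsto_intros cyl)
    then have "\<forall>\<^sub>F j in G. dist (\<integral>a. g a \<partial>M j) (\<integral>a. g a \<partial>L) < \<epsilon> / 3"
      using \<epsilon> by (intro tendstoD) auto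
    then show "\<forall>\<^sub>F j in G. dist (\<integral>a. h a \<partial>M j) (\<integral>a. h a \<partial>L) < \<epsilon>"
    proof eventually_elim
      case (elim j)
      then show ?case using close[OF M[of j]] close[OF L] unfolding dist_real_def by linarith
    qed
  qed
qed

text \<open>
  In the expansion of a cylinder, only the mode of the zero word has a nonzero limit, namely 1.
\<close>

lemma equidistribution_criterion:
  fixes M :: "'i \<Rightarrow> (int \<Rightarrow> 'p::prime_card mod_ring) measure"
  assumes M: "\<And>j. config_prob (M j)"
    and modes: "\<And>k u. nontrivial_character config_topology (fourier_mode k u)
        \<Longrightarrow> ((\<lambda>j. \<integral>a. fourier_mode k u a \<partial>M j) \<longlongrightarrow> 0) G"
  shows "weak_star_tendsto M uniform_bernoulli G"
proof (rule weak_star_tendstoI[OF M uniform_bernoulli_config_prob])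
  fix k and w :: "'p mod_ring list"
  let ?m = "length w"
  let ?c = "\<lambda>u. \<Prod>i<?m. basic_character (- (u ! i * w ! i))"
  let ?z = "replicate ?m (0 :: 'p mod_ring)"
  have lim: "((\<lambda>j. \<integral>a. fourier_mode k u a \<partial>M j) \<longlongrightarrow> (if u = ?z then 1 else 0)) G" if "u \<in> words ?m" for u
  proof (cases "u = ?z")
    case True
    have "(\<integral>a. fourier_mode k u a \<partial>M j) = 1" for j
    proof -
      interpret prob_space "M j" using config_prob_facts[OF M] by simp
      show ?thesis using True by (simp add: fourier_mode_trivial prob_space)
    qed
    then show ?thesis using True by simp
  next
    case False
    have "\<exists>i<length u. u ! i \<noteq> 0"
    proof (rule ccontr)
      assume "\<not> ?thesis"
      then have "u = ?z" using that by (intro nth_equalityI) (auto simp: words_def)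
      then show False using False by simp
    qed
    then obtain i where "i < length u" "u ! i \<noteq> 0" by blast
    then show ?thesis using modes[OF nontrivial_fourier_mode] False by simp
  qed
  have "((\<lambda>j. \<Sum>u\<in>words ?m. ?c u * (\<integral>a. fourier_mode k u a \<partial>M j)) \<longlongrightarrow> (\<Sum>u\<in>words ?m. ?c u * (if u = ?z then 1 else 0))) G"
    using lim by (intro tendsto_sum tendsto_mult tendsto_const) auto
  also have "(\<Sum>u\<in>words ?m. ?c u * (if u = ?z then 1 else 0)) = 1"
  proof -
    have "?z \<in> words ?m" by (simp add: words_def)
    then have "(\<Sum>u\<in>words ?m. ?c u * (if u = ?z then 1 else 0)) = ?c ?z"
      by (simp add: if_distrib cong: if_cong)
    then show ?thesis using basic_character_eq_1[of "0 :: 'p mod_ring"] by simp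
  qed
  finally have "((\<lambda>j. of_nat (CARD('p) ^ ?m) * complex_of_real (measure (M j) (cylinder k w))) \<longlongrightarrow> 1) G"
    unfolding measure_cylinder_fourier[OF M] .
  then have "((\<lambda>j. Re (of_nat (CARD('p) ^ ?m) * complex_of_real (measure (M j) (cylinder k w)))) \<longlongrightarrow> Re 1) G"
    by (rule tendsto_Re)
  then have "((\<lambda>j. real (CARD('p) ^ ?m) * measure (M j) (cylinder k w)) \<longlongrightarrow> 1) G"
    by simp
  then have "((\<lambda>j. (real (CARD('p) ^ ?m) * measure (M j) (cylinder k w)) / real (CARD('p) ^ ?m)) \<longlongrightarrow> 1 / real (CARD('p) ^ ?m)) G"
    by (intro tendsto_divide tendsto_const) auto
  then show "((\<lambda>j. measure (M j) (cylinder k w)) \<longlongrightarrow> measure uniform_bernoulli (cylinder k w)) G"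
    by (simp add: uniform_bernoulli_cylinder)
qed

section \<open>Sets of density one\<close>

lemma cesaro_density_one_iff:
  "cesaro_density_one J \<longleftrightarrow> (\<forall>\<epsilon>>0. \<forall>\<^sub>F N in sequentially. (1 - \<epsilon>) * real N \<le> real (card (J \<inter> {0..<N})))"
proof
  assume J: "cesaro_density_one J"
  show "\<forall>\<epsilon>>0. \<forall>\<^sub>F N in sequentially. (1 - \<epsilon>) * real N \<le> real (card (J \<inter> {0..<N}))"
  proof (intro allI impI)
    fix \<epsilon> :: real assume "0 < \<epsilon>"
    then have "\<forall>\<^sub>F N in sequentially. 1 - \<epsilon> < real (card (J \<inter> {0..<N})) / real N"
      using J unfolding cesaro_density_one_def by (intro order_tendstoD(1)) auto
    then show "\<forall>\<^sub>F N in sequentially. (1 - \<epsilon>) * real N \<le> real (card (J \<inter> {0..<N}))"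
      using eventually_gt_at_top[of 0] by eventually_elim (simp add: field_simps)
  qed
next
  assume J: "\<forall>\<epsilon>>0. \<forall>\<^sub>F N in sequentially. (1 - \<epsilon>) * real N \<le> real (card (J \<inter> {0..<N}))"
  show "cesaro_density_one J"
    unfolding cesaro_density_one_def
  proof (rule tendstoI)
    fix \<epsilon> :: real assume "0 < \<epsilon>"
    then have "\<forall>\<^sub>F N in sequentially. (1 - \<epsilon> / 2) * real N \<le> real (card (J \<inter> {0..<N}))"
      using J by auto
    then show "\<forall>\<^sub>F N in sequentially. dist (real (card (J \<inter> {0..<N})) / real N) 1 < \<epsilon>"
      using eventually_gt_at_top[of 0]
    proof eventually_elim
      case (elim N)
      have "card (J \<inter> {0..<N}) \<le> N" using card_mono[of "{0..<N}" "J \<inter> {0..<N}"] by simp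
      then have "real (card (J \<inter> {0..<N})) / real N \<le> 1" using elim by simp
      moreover have "1 - \<epsilon> / 2 \<le> real (card (J \<inter> {0..<N})) / real N" using elim by (simp add: field_simps)
      ultimately show ?case using \<open>0 < \<epsilon>\<close> unfolding dist_real_def by linarith
    qed
  qed
qed

lemma cesaro_density_one_Int:
  assumes A: "cesaro_density_one A" and B: "cesaro_density_one B"
  shows "cesaro_density_one (A \<inter> B)"
  unfolding cesaro_density_one_iff
proof (intro allI impI)
  fix \<epsilon> :: real assume "0 < \<epsilon>"
  then have "\<forall>\<^sub>F N in sequentially. (1 - \<epsilon> / 2) * real N \<le> real (card (A \<inter> {0..<N}))"
    "\<forall>\<^sub>F N in sequentially. (1 - \<epsilon> / 2) * real N \<le> real (card (B \<inter> {0..<N}))"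
    using A B unfolding cesaro_density_one_iff by auto
  then show "\<forall>\<^sub>F N in sequentially. (1 - \<epsilon>) * real N \<le> real (card (A \<inter> B \<inter> {0..<N}))"
  proof eventually_elim
    case (elim N)
    let ?A = "A \<inter> {0..<N}" and ?B = "B \<inter> {0..<N}"
    have "card (?A \<union> ?B) \<le> N" using card_mono[of "{0..<N}" "?A \<union> ?B"] by auto
    moreover have "card ?A + card ?B = card (?A \<union> ?B) + card (?A \<inter> ?B)"
      by (rule card_Un_Int) auto
    moreover have "?A \<inter> ?B = A \<inter> B \<inter> {0..<N}" by auto
    ultimately have "real (card ?A) + real (card ?B) \<le> real N + real (card (A \<inter> B \<inter> {0..<N}))"
      by (metis add_mono_thms_linordered_semiring(3) of_nat_add of_nat_mono)
    then show ?case using elim by (simp add: algebra_simps)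
  qed
qed

text \<open>
  Let \<open>D m\<close> be the intersection of the first sets.  Past the time \<open>T m\<close> the density of \<open>D m\<close>
  stays above \<open>1 - 1 / Suc m\<close>, and only from then on is membership in \<open>J m\<close> demanded.  On
  \<open>[0, N)\<close> the resulting set contains \<open>D l\<close> for the largest \<open>l\<close> with \<open>T l \<le> N\<close>.
\<close>

lemma cesaro_density_one_diagonal:
  fixes J :: "nat \<Rightarrow> nat set"
  assumes J: "\<And>m. cesaro_density_one (J m)"
  obtains K where "cesaro_density_one K" "\<And>m. \<forall>\<^sub>F j in sequentially. j \<in> K \<longrightarrow> j \<in> J m"
proof -
  define D where "D m = (\<Inter>i\<le>m. J i)" for m
  have D: "cesaro_density_one (D m)" for m
  proof (induction m)
    case (Suc m)
    have "D (Suc m) = D m \<inter> J (Suc m)" by (auto simp: D_def le_Suc_eq)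
    then show ?case using cesaro_density_one_Int[OF Suc J] by simp
  qed (simp add: D_def J)
  have "\<exists>t. \<forall>N\<ge>t. (1 - 1 / Suc m) * real N \<le> real (card (D m \<inter> {0..<N}))" for m
    using D[of m] unfolding cesaro_density_one_iff eventually_sequentially
    by (metis divide_pos_pos of_nat_0_less_iff zero_less_Suc zero_less_one)
  then obtain t where t: "\<And>m N. t m \<le> N \<Longrightarrow> (1 - 1 / Suc m) * real N \<le> real (card (D m \<inter> {0..<N}))"
    by metis
  \<comment> \<open>The maximum with \<open>m\<close> makes \<open>{l. T l \<le> N}\<close> finite.\<close>
  define T where "T m = max m (t m)" for m
  define K where "K = {j. \<forall>m. T m \<le> j \<longrightarrow> j \<in> J m}"
  have "cesaro_density_one K"
    unfolding cesaro_density_one_iff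
  proof (intro allI impI)
    fix \<epsilon> :: real assume "0 < \<epsilon>"
    then obtain m where m: "1 / Suc m < \<epsilon>"
      using reals_Archimedean by (metis inverse_eq_divide)
    show "\<forall>\<^sub>F N in sequentially. (1 - \<epsilon>) * real N \<le> real (card (K \<inter> {0..<N}))"
      using eventually_ge_at_top[of "T m"]
    proof eventually_elim
      case (elim N)
      define l where "l = Max {l. T l \<le> N}"
      have fin: "finite {l. T l \<le> N}"
        by (rule finite_subset[of _ "{..N}"]) (auto simp: T_def)
      have l: "T l \<le> N" "m \<le> l"
        using Max_in[OF fin] Max_ge[OF fin, of m] elim by (auto simp: l_def)
      have "D l \<inter> {0..<N} \<subseteq> K \<inter> {0..<N}"
      proof
        fix j assume j: "j \<in> D l \<inter> {0..<N}"
        have "j \<in> J i" if "T i \<le> j" for i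
        proof -
          have "i \<le> l" using that j Max_ge[OF fin, of i] by (auto simp: l_def)
          then show ?thesis using j by (auto simp: D_def)
        qed
        then show "j \<in> K \<inter> {0..<N}" using j by (auto simp: K_def)
      qed
      then have "card (D l \<inter> {0..<N}) \<le> card (K \<inter> {0..<N})" by (intro card_mono) auto
      moreover have "(1 - 1 / Suc l) * real N \<le> real (card (D l \<inter> {0..<N}))"
        using l(1) by (intro t) (simp add: T_def)
      moreover have "(1 - \<epsilon>) * real N \<le> (1 - 1 / Suc l) * real N"
      proof (rule mult_right_mono)
        have "1 / real (Suc l) \<le> 1 / Suc m" using l(2) by (intro divide_left_mono) auto
        then show "1 - \<epsilon> \<le> 1 - 1 / real (Suc l)" using m by simp
      qed simp
      ultimately show ?case by simp
    qed
  qed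
  moreover have "\<forall>\<^sub>F j in sequentially. j \<in> K \<longrightarrow> j \<in> J m" for m
    using eventually_ge_at_top[of "T m"] by eventually_elim (auto simp: K_def)
  ultimately show thesis using that by blast
qed

lemma seq_in_le:
  assumes "\<forall>\<^sub>F j in sequentially. j \<in> K \<longrightarrow> j \<in> J"
  shows "seq_in K \<le> seq_in J"
  unfolding seq_in_def
  by (rule filter_leI) (use assms in \<open>auto simp: eventually_inf_principal elim: eventually_elim2\<close>)

section \<open>Randomization by dispersive automata\<close>

lemma linear_CA_additive:
  assumes "linear_CA \<Phi>"
  shows "(\<Phi> ^^ j) (a + b) = (\<Phi> ^^ j) a + (\<Phi> ^^ j) b"
proof -
  have add: "\<Phi> (x + y) = \<Phi> x + \<Phi> y" for x y
    using assms unfolding linear_CA_def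
    by (auto simp: fun_eq_iff config_shift_def distrib_left sum.distrib)
  show ?thesis
  proof (induction j)
    case (Suc j)
    show ?case by (simp only: funpow.simps o_apply Suc add)
  qed simp
qed

lemma linear_CA_continuous:
  assumes "linear_CA \<Phi>"
  shows "continuous_map config_topology config_topology (\<Phi> ^^ j)"
proof -
  obtain F and \<phi> :: "int \<Rightarrow> int" where F: "finite F"
    "\<Phi> = (\<lambda>a m. \<Sum>f\<in>F. of_int (\<phi> f) * config_shift f a m)"
    using assms unfolding linear_CA_def by auto
  have "continuous_map config_topology config_topology \<Phi>"
  proof (rule continuous_mapI_window)
    fix k
    show "\<exists>K. finite K \<and> (\<forall>b b'. (\<forall>i\<in>K. b i = b' i) \<longrightarrow> \<Phi> b k = \<Phi> b' k)"
      unfolding F(2) using F(1)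
      by (intro exI[of _ "(\<lambda>f. k - f) ` F"]) (auto simp: config_shift_def intro!: sum.cong)
  qed
  then show ?thesis
    by (induction j) (auto simp: continuous_map_id id_def[symmetric] intro: continuous_map_compose)
qed

lemma character_comp_linear_CA:
  assumes "linear_CA \<Phi>" "character config_topology \<theta>"
  shows "character config_topology (\<theta> \<circ> (\<Phi> ^^ j))"
  using assms continuous_map_compose[OF linear_CA_continuous[OF assms(1), of j]]
  by (auto simp: character_def linear_CA_additive)

theorem corollary5p3:
  fixes \<mu> :: "(int \<Rightarrow> 'p::prime_card mod_ring) measure"
    and \<Phi> :: "(int \<Rightarrow> 'p mod_ring) \<Rightarrow> (int \<Rightarrow> 'p mod_ring)"
  assumes "quasi_markov TYPE('b::finite) \<mu>"
    and "shift_mixing \<mu>"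
    and not_point_mass: "\<And>a. measure \<mu> {a} \<noteq> 1"
    and "linear_CA \<Phi>"
    and "dispersive \<Phi>"
  shows "asymptotically_randomizes \<Phi> \<mu>"
proof -
  note lin = \<open>linear_CA \<Phi>\<close>
  have \<mu>: "config_prob \<mu>" using assms(1) by (rule quasi_markov_config_prob)
  obtain S \<rho> :: real where S: "0 < S" and \<rho>: "0 \<le> \<rho>" "\<rho> < 1" and decay:
    "\<And>\<theta>. character config_topology \<theta> \<Longrightarrow> norm (\<integral>a. \<theta> a \<partial>\<mu>) \<le> \<rho> ^ char_rank S \<theta>"
    using quasi_markov_character_decay[OF assms(1) not_point_mass] by blast
  define M where "M j = distr \<mu> config_space (\<Phi> ^^ j)" for j
  have meas: "\<Phi> ^^ j \<in> measurable \<mu> config_space" for j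
    using measurable_continuous_config[OF linear_CA_continuous[OF lin]] config_prob_facts[OF \<mu>]
    by (simp cong: measurable_cong_sets)
  have M: "config_prob (M j)" for j
    unfolding config_prob_def M_def
    using prob_space.prob_space_distr[OF config_prob_facts(1)[OF \<mu>] meas] by simp
  have "\<exists>J. cesaro_density_one J \<and> (nontrivial_character config_topology \<theta> \<longrightarrow>
      ((\<lambda>j. \<integral>a. \<theta> a \<partial>M j) \<longlongrightarrow> 0) (seq_in J))" for \<theta>
  proof (cases "nontrivial_character config_topology \<theta>")
    case True
    then have \<theta>: "character config_topology \<theta>" by (simp add: nontrivial_character_def)
    obtain J where J: "cesaro_density_one J"
      "filterlim (\<lambda>j. char_rank S (\<theta> \<circ> (\<Phi> ^^ j))) at_top (seq_in J)"
      using \<open>dispersive \<Phi>\<close> S True unfolding dispersive_def by blast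
    have bound: "norm (\<integral>a. \<theta> a \<partial>M j) \<le> \<rho> ^ char_rank S (\<theta> \<circ> (\<Phi> ^^ j))" for j
    proof -
      have "(\<integral>a. \<theta> a \<partial>M j) = (\<integral>a. (\<theta> \<circ> (\<Phi> ^^ j)) a \<partial>\<mu>)"
        unfolding M_def using \<theta>
        by (subst integral_distr[OF meas])
          (auto simp: character_def comp_def intro: borel_measurable_continuous_config)
      then show ?thesis using decay[OF character_comp_linear_CA[OF lin \<theta>]] by simp
    qed
    have "((\<lambda>j. \<rho> ^ char_rank S (\<theta> \<circ> (\<Phi> ^^ j))) \<longlongrightarrow> 0) (seq_in J)"
      by (rule filterlim_compose[OF LIMSEQ_realpow_zero[OF \<rho>] J(2)])
    then have "((\<lambda>j. \<integral>a. \<theta> a \<partial>M j) \<longlongrightarrow> 0) (seq_in J)"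
      by (rule Lim_null_comparison[OF always_eventually[OF allI[OF bound]]])
    then show ?thesis using J(1) by blast
  next
    case False
    have "cesaro_density_one UNIV"
      unfolding cesaro_density_one_iff by (auto simp: algebra_simps)
    then show ?thesis using False by blast
  qed
  then obtain J where J: "\<And>\<theta>. cesaro_density_one (J \<theta>)"
    "\<And>\<theta>. nontrivial_character config_topology \<theta> \<Longrightarrow> ((\<lambda>j. \<integral>a. \<theta> a \<partial>M j) \<longlongrightarrow> 0) (seq_in (J \<theta>))"
    by metis
  define mode :: "nat \<Rightarrow> (int \<Rightarrow> 'p mod_ring) \<Rightarrow> complex"
    where "mode m = (case from_nat m of (k, u) \<Rightarrow> fourier_mode k u)" for m
  obtain K where K: "cesaro_density_one K" "\<And>m. \<forall>\<^sub>F j in sequentially. j \<in> K \<longrightarrow> j \<in> J (mode m)"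
    using cesaro_density_one_diagonal[of "\<lambda>m. J (mode m)"] J(1) by blast
  have "weak_star_tendsto M uniform_bernoulli (seq_in K)"
  proof (rule equidistribution_criterion[OF M])
    fix k and u :: "'p mod_ring list" assume nt: "nontrivial_character config_topology (fourier_mode k u)"
    have "mode (to_nat (k, u)) = fourier_mode k u" by (simp add: mode_def)
    then have "seq_in K \<le> seq_in (J (fourier_mode k u))" using seq_in_le[OF K(2)[of "to_nat (k, u)"]] by simp
    then show "((\<lambda>j. \<integral>a. fourier_mode k u a \<partial>M j) \<longlongrightarrow> 0) (seq_in K)"
      using J(2)[OF nt] by (rule tendsto_mono)
  qed
  then show ?thesis
    unfolding asymptotically_randomizes_def M_def using K(1) by blast
qed

end
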